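(* Let $E$ be a Banach lattice. The following assertions are equivalent: (1) the lattice operations of $E$ are sequentially weakly continuous; (2) for every Banach space $X$, every weakly compact operator $T\colon X\to E$ is sequentially $uaw$-compact; (3) every weakly compact operator $T\colon \ell^1\to E$ is sequentially $uaw$-compact.
   Context: Operator means bounded linear operator. $E^+$ denotes the positive cone of $E$. The lattice operations of $E$ are sequentially weakly continuous if for every sequence $(x_n)\subset E$, $x_n\to0$ weakly implies $|x_n|\to0$ weakly. A sequence $(x_n)$ in $E$ is $uaw$-convergent to $x\in E$ if $|x_n-x|\wedge u\to0$ weakly for every $u\in E^+$. An operator $T\colon X\to E$ from a Banach space $X$ is sequentially $uaw$-compact if for every norm bounded sequence $(x_n)$ in $X$ the sequence $(Tx_n)$ has a subsequence which is $uaw$-convergent in $E$. *)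

theory Defs
  imports "HOL-Analysis.Analysis" "HOL-Library.Lattice_Algebras"
begin

section \<open>Banach lattices\<close>

class banach_lattice = banach + ordered_real_vector + lattice_ab_group_add_abs +
  assumes norm_mono_abs: "\<bar>x\<bar> \<le> \<bar>y\<bar> \<Longrightarrow> norm x \<le> norm y"

instance real :: banach_lattice
  by standard simp


section \<open>The weak topology\<close>

text \<open>
  The initial topology with respect to all bounded linear functionals: the topology pulled back
  from the product topology along the evaluation map into the functions on the dual.
\<close>

definition weak_topology :: "'e::real_normed_vector topology" where
  "weak_topology = pullback_topology UNIV (\<lambda>x (f :: 'e \<Rightarrow>\<^sub>L real). blinfun_apply f x) euclidean"

definition weakly_tendsto :: "(nat \<Rightarrow> 'e::real_normed_vector) \<Rightarrow> 'e \<Rightarrow> bool" where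
  "weakly_tendsto s l \<longleftrightarrow> limitin weak_topology s l sequentially"

lemma weakly_tendsto_iff:
  "weakly_tendsto s l \<longleftrightarrow>
     (\<forall>f :: 'e::real_normed_vector \<Rightarrow>\<^sub>L real. (\<lambda>n. blinfun_apply f (s n)) \<longlonglongrightarrow> blinfun_apply f l)"
proof -
  let ?ev = "\<lambda>x (f :: 'e \<Rightarrow>\<^sub>L real). blinfun_apply f x"
  have "weakly_tendsto s l \<longleftrightarrow>
      (\<forall>U. open U \<and> ?ev l \<in> U \<longrightarrow> (\<forall>\<^sub>F n in sequentially. ?ev (s n) \<in> U))" (is "?L \<longleftrightarrow> ?R")
  proof
    assume L: ?L
    show ?R
    proof (intro allI impI, elim conjE)
      fix U assume "open U" "?ev l \<in> U"
      moreover from \<open>open U\<close> have "openin weak_topology (?ev -` U)"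
        unfolding weak_topology_def by (subst openin_pullback_topology) auto
      ultimately show "\<forall>\<^sub>F n in sequentially. ?ev (s n) \<in> U"
        using L by (auto simp: weakly_tendsto_def limitin_def)
    qed
  next
    assume ?R
    then show ?L
      by (auto simp: weakly_tendsto_def limitin_def weak_topology_def openin_pullback_topology
          topspace_pullback_topology)
  qed
  also have "\<dots> \<longleftrightarrow> limitin euclidean (\<lambda>n. ?ev (s n)) (?ev l) sequentially"
    by (simp add: limitin_def)
  also have "\<dots> \<longleftrightarrow> (\<forall>f. (\<lambda>n. ?ev (s n) f) \<longlonglongrightarrow> ?ev l f)"
    unfolding euclidean_product_topology[symmetric] by (simp add: limitin_componentwise)
  finally show ?thesis .
qed

definition lattice_ops_seq_weakly_continuous :: "'e::banach_lattice itself \<Rightarrow> bool" where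
  "lattice_ops_seq_weakly_continuous _ \<longleftrightarrow>
     (\<forall>s :: nat \<Rightarrow> 'e. weakly_tendsto s 0 \<longrightarrow> weakly_tendsto (\<lambda>n. \<bar>s n\<bar>) 0)"

definition uaw_tendsto :: "(nat \<Rightarrow> 'e::banach_lattice) \<Rightarrow> 'e \<Rightarrow> bool" where
  "uaw_tendsto s l \<longleftrightarrow> (\<forall>u\<ge>0. weakly_tendsto (\<lambda>n. inf \<bar>s n - l\<bar> u) 0)"


section \<open>Banach spaces with an explicit carrier\<close>

text \<open>
  The domain of an operator ranges over all Banach spaces inside a formula, so it cannot be given
  by a type of class \<^class>\<open>banach\<close>; it is a set with operations. Nothing is required of the
  operations, or of operators, outside the carrier.
\<close>

record 'x nspace =
  carr :: "'x set"
  add :: "'x \<Rightarrow> 'x \<Rightarrow> 'x"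
  zero :: 'x
  scl :: "real \<Rightarrow> 'x \<Rightarrow> 'x"
  nrm :: "'x \<Rightarrow> real"

definition diff :: "'x nspace \<Rightarrow> 'x \<Rightarrow> 'x \<Rightarrow> 'x" where
  "diff X x y = add X x (scl X (-1) y)"

locale banach_space =
  fixes X :: "'x nspace"
  assumes zero_closed: "zero X \<in> carr X"
    and add_closed: "\<lbrakk>x \<in> carr X; y \<in> carr X\<rbrakk> \<Longrightarrow> add X x y \<in> carr X"
    and scl_closed: "x \<in> carr X \<Longrightarrow> scl X a x \<in> carr X"
    and add_assoc: "\<lbrakk>x \<in> carr X; y \<in> carr X; z \<in> carr X\<rbrakk>
          \<Longrightarrow> add X (add X x y) z = add X x (add X y z)"
    and add_commute: "\<lbrakk>x \<in> carr X; y \<in> carr X\<rbrakk> \<Longrightarrow> add X x y = add X y x"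
    and add_zero: "x \<in> carr X \<Longrightarrow> add X x (zero X) = x"
    and diff_self: "x \<in> carr X \<Longrightarrow> diff X x x = zero X"
    and scl_add_right: "\<lbrakk>x \<in> carr X; y \<in> carr X\<rbrakk>
          \<Longrightarrow> scl X a (add X x y) = add X (scl X a x) (scl X a y)"
    and scl_add_left: "x \<in> carr X \<Longrightarrow> scl X (a + b) x = add X (scl X a x) (scl X b x)"
    and scl_scl: "x \<in> carr X \<Longrightarrow> scl X a (scl X b x) = scl X (a * b) x"
    and scl_one: "x \<in> carr X \<Longrightarrow> scl X 1 x = x"
    and nrm_nonneg: "x \<in> carr X \<Longrightarrow> 0 \<le> nrm X x"
    and nrm_eq_0: "x \<in> carr X \<Longrightarrow> nrm X x = 0 \<longleftrightarrow> x = zero X"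
    and nrm_triangle: "\<lbrakk>x \<in> carr X; y \<in> carr X\<rbrakk> \<Longrightarrow> nrm X (add X x y) \<le> nrm X x + nrm X y"
    and nrm_scl: "x \<in> carr X \<Longrightarrow> nrm X (scl X a x) = \<bar>a\<bar> * nrm X x"
    and complete: "\<lbrakk>\<And>n. s n \<in> carr X;
          \<And>e. e > 0 \<Longrightarrow> \<exists>N. \<forall>m\<ge>N. \<forall>n\<ge>N. nrm X (diff X (s m) (s n)) < e\<rbrakk>
          \<Longrightarrow> \<exists>x\<in>carr X. (\<lambda>n. nrm X (diff X (s n) x)) \<longlonglongrightarrow> 0"

lemma banach_space_type:
  "banach_space \<lparr>carr = (UNIV :: 'a::banach set), add = (+), zero = 0, scl = (*\<^sub>R), nrm = norm\<rparr>"
proof (unfold_locales, goal_cases)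
  case (16 s)
  then have "Cauchy s"
    by (simp add: diff_def Cauchy_iff)
  then obtain x where "s \<longlonglongrightarrow> x"
    using Cauchy_convergent convergent_def by blast
  then have "(\<lambda>n. norm (s n - x)) \<longlonglongrightarrow> 0"
    using Lim_null tendsto_norm_zero by blast
  then show ?case
    by (auto simp: diff_def)
qed (auto simp: diff_def algebra_simps norm_triangle_ineq)

definition ell1 :: "(nat \<Rightarrow> real) nspace" where
  "ell1 = \<lparr>carr = {a. summable (\<lambda>n. \<bar>a n\<bar>)},
           add = (\<lambda>a b n. a n + b n), zero = (\<lambda>n. 0), scl = (\<lambda>c a n. c * a n),
           nrm = (\<lambda>a. \<Sum>n. \<bar>a n\<bar>)\<rparr>"


section \<open>Operators from a Banach space into a Banach lattice\<close>

definition bounded_operator :: "'x nspace \<Rightarrow> ('x \<Rightarrow> 'e::real_normed_vector) \<Rightarrow> bool" where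
  "bounded_operator X T \<longleftrightarrow>
     (\<forall>x\<in>carr X. \<forall>y\<in>carr X. T (add X x y) = T x + T y) \<and>
     (\<forall>a. \<forall>x\<in>carr X. T (scl X a x) = a *\<^sub>R T x) \<and>
     (\<exists>K. \<forall>x\<in>carr X. norm (T x) \<le> K * nrm X x)"

definition weakly_compact_operator :: "'x nspace \<Rightarrow> ('x \<Rightarrow> 'e::real_normed_vector) \<Rightarrow> bool" where
  "weakly_compact_operator X T \<longleftrightarrow> bounded_operator X T \<and>
     compactin weak_topology (weak_topology closure_of (T ` {x \<in> carr X. nrm X x \<le> 1}))"

definition seq_uaw_compact_operator :: "'x nspace \<Rightarrow> ('x \<Rightarrow> 'e::banach_lattice) \<Rightarrow> bool" where
  "seq_uaw_compact_operator X T \<longleftrightarrow> bounded_operator X T \<and>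
     (\<forall>s. (\<forall>n. s n \<in> carr X) \<and> (\<exists>M. \<forall>n. nrm X (s n) \<le> M) \<longrightarrow>
        (\<exists>r l. strict_mono (r :: nat \<Rightarrow> nat) \<and> uaw_tendsto (\<lambda>n. T (s (r n))) l))"

text \<open>
  A formula can only quantify over Banach spaces whose carrier lies in one fixed type. In
  statements about all Banach spaces that type is \<open>'u + (nat \<Rightarrow> real)\<close> with \<open>'u\<close> arbitrary:
  every Banach space over any type \<open>'u\<close> has its copy there under \<^const>\<open>Inl\<close>, and whatever
  \<open>'u\<close> is, there is room for a copy of \<^const>\<open>ell1\<close>, so that a small \<open>'u\<close> does not make the
  quantification vacuous.
\<close>

end

theory Submission
  imports Defs
begin

text \<open>
  For (1) implies (2), the image of a bounded sequence has a weakly convergent subsequence by the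
  Eberlein-Smulian theorem, and (1) turns this into uaw-convergence. For (3) implies (1), a weakly null
  sequence \<open>x\<close> is the image of the unit vectors under \<open>a \<mapsto> \<Sum>n. a n *\<^sub>R x n\<close>, which is weakly compact;
  hence every subsequence of \<open>x\<close> has a uaw-convergent subsequence. A weakly convergent sequence \<open>y\<close>
  with \<open>inf \<bar>y n\<bar> u\<close> weakly null for all \<open>u\<close> satisfies \<open>h \<bar>y n\<bar> \<longlonglongrightarrow> 0\<close> for positive \<open>h\<close>: otherwise an
  almost disjoint subsequence would span \<open>\<ell>\<^sup>1\<close> in the seminorm \<open>h \<bar>\<cdot>\<bar>\<close>, so that a functional could
  take values bounded away from \<open>0\<close> and of alternating signs on it.
\<close>

text \<open>Being uaw-null says little about values of functionals: the unit vectors of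
  \<open>ell1\<close> are uaw-null without being weakly null. Weak convergence of \<open>y\<close>
  therefore has to enter, and it does so through the signs. The weak limit of \<open>y\<close> is
  not assumed to be \<open>0\<close>, so a functional that merely stays away from \<open>0\<close>
  along a subsequence contradicts nothing; one that alternates does. The modulus does not see signs,
  so they may be inserted freely before the functional is built. The same generality lets the
  unspecified uaw-limit be subtracted first and identified with the weak limit afterwards. The
  functionals come from one form of Hahn-Banach: a sublinear \<open>p\<close> gives upper bounds,
  and a cone \<open>D\<close> of pairs gives lower bounds. Assertion (3) follows from (2) by placing
  a copy of \<open>ell1\<close> inside the type over which (2) quantifies.\<close>

section \<open>Sublinear functions and the Hahn-Banach theorem\<close>

definition sublinear :: "('a::real_vector \<Rightarrow> real) \<Rightarrow> bool" where
  "sublinear p \<longleftrightarrow> (\<forall>x y. p (x + y) \<le> p x + p y) \<and> (\<forall>c x. 0 \<le> c \<longrightarrow> p (c *\<^sub>R x) = c * p x)"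

lemma sublinear_add: "sublinear p \<Longrightarrow> p (x + y) \<le> p x + p y"
  and sublinear_scaleR: "sublinear p \<Longrightarrow> 0 \<le> c \<Longrightarrow> p (c *\<^sub>R x) = c * p x"
  by (auto simp: sublinear_def)

lemma sublinear_zero: "sublinear p \<Longrightarrow> p 0 = 0"
  using sublinear_scaleR[of p 0 0] by simp

lemma sublinear_minus_le: "sublinear p \<Longrightarrow> - p (- x) \<le> p x"
  using sublinear_add[of p x "- x"] sublinear_zero[of p] by simp

lemma sublinear_lower: "sublinear p \<Longrightarrow> p y - p (- x) \<le> p (x + y)"
  using sublinear_add[of p "x + y" "- x"] by simp

text \<open>One inequality suffices for homogeneity: applied to \<open>inverse c\<close> and
  \<open>c *\<^sub>R x\<close> it yields the reverse one.\<close>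

lemma sublinearI:
  assumes add: "\<And>x y. p (x + y) \<le> p x + p y"
    and scale: "\<And>c x. 0 < c \<Longrightarrow> p (c *\<^sub>R x) \<le> c * p x"
    and zero: "p 0 = 0"
  shows "sublinear p"
  unfolding sublinear_def
proof (intro conjI allI impI add)
  fix c :: real and x :: 'a
  assume "0 \<le> c"
  show "p (c *\<^sub>R x) = c * p x"
  proof (cases "c = 0")
    case False
    with \<open>0 \<le> c\<close> have c: "0 < c" by simp
    have "p x \<le> inverse c * p (c *\<^sub>R x)"
      using scale[of "inverse c" "c *\<^sub>R x"] c by simp
    then have "c * p x \<le> p (c *\<^sub>R x)"
      using c by (simp add: field_simps)
    with scale[OF c] show ?thesis by (simp add: antisym)
  qed (simp add: zero)
qed

text \<open>The cone generated by a single constraint \<open>v = (z, t)\<close>; homogeneity of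
  \<open>p\<close> reduces domination on it to one vector.\<close>

lemma convex_cone_ray: "convex_cone ((\<lambda>s. s *\<^sub>R v) ` {0..})"
  for v :: "'a::real_vector"
  by (rule convex_cone_linear_image) (auto simp: convex_cone_iff linear_scaleR_left)

lemma sublinear_norm: "sublinear norm"
  by (simp add: sublinear_def norm_triangle_ineq)

text \<open>
  Lowering a sublinear function along a cone of constraints \<open>(z, t)\<close>, each to be read as
  ``at least \<open>t\<close> at \<open>z\<close>''.
\<close>

locale constrained_sublinear =
  fixes p :: "'a::real_vector \<Rightarrow> real" and D :: "('a \<times> real) set"
  assumes sublinear: "sublinear p"
    and cone: "convex_cone D"
    and dominated: "(z, t) \<in> D \<Longrightarrow> t \<le> p z"
begin

lemma zero_mem: "(0, 0) \<in> D"
  using convex_cone_contains_0[OF cone] by (simp add: zero_prod_def)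

lemma add_mem: "\<lbrakk>(z, t) \<in> D; (z', t') \<in> D\<rbrakk> \<Longrightarrow> (z + z', t + t') \<in> D"
  using convex_cone_add[OF cone, of "(z, t)" "(z', t')"] by simp

lemma scale_mem: "\<lbrakk>(z, t) \<in> D; 0 < c\<rbrakk> \<Longrightarrow> (c *\<^sub>R z, c * t) \<in> D"
  using convex_cone_scaleR[OF cone, of c "(z, t)"] by simp

text \<open>For linear \<open>g \<le> p\<close> meeting all constraints,
  \<open>g x = g (x + z) - g z \<le> p (x + z) - t\<close>. The infimum is the best upper bound that
  these inequalities provide, and conversely every linear function below it meets the
  constraints.\<close>

definition lowered :: "'a \<Rightarrow> real" where
  "lowered x = (INF d\<in>D. p (x + fst d) - snd d)"

lemma lowered_bdd: "bdd_below ((\<lambda>d. p (x + fst d) - snd d) ` D)"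
proof (rule bdd_belowI2)
  fix d assume "d \<in> D"
  then show "- p (- x) \<le> p (x + fst d) - snd d"
    using dominated[of "fst d" "snd d"] sublinear_lower[OF sublinear, of "fst d" x] by simp
qed

lemma lowered_le: "(z, t) \<in> D \<Longrightarrow> lowered x \<le> p (x + z) - t"
  unfolding lowered_def using cINF_lower[OF lowered_bdd, of "(z, t)" x] by simp

lemma le_lowered: "(\<And>z t. (z, t) \<in> D \<Longrightarrow> b \<le> p (x + z) - t) \<Longrightarrow> b \<le> lowered x"
  unfolding lowered_def using zero_mem by (intro cINF_greatest) auto

lemma lowered_le_self: "lowered x \<le> p x"
  using lowered_le[OF zero_mem] by simp

lemma sublinear_lowered: "sublinear lowered"
proof (rule sublinearI)
  fix x y
  \<comment> \<open>A constraint used for \<open>x\<close> and one used for \<open>y\<close> add up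
    to a constraint for \<open>x + y\<close>; the two infima are taken one after the other.\<close>
  have "lowered (x + y) - lowered y \<le> p (x + z) - t" if zt: "(z, t) \<in> D" for z t
  proof -
    have "lowered (x + y) - (p (x + z) - t) \<le> lowered y"
    proof (rule le_lowered)
      fix z' t' assume "(z', t') \<in> D"
      then have "lowered (x + y) \<le> p ((x + y) + (z + z')) - (t + t')"
        using zt by (intro lowered_le add_mem)
      also have "(x + y) + (z + z') = (x + z) + (y + z')"
        by simp
      also have "p \<dots> \<le> p (x + z) + p (y + z')"
        by (rule sublinear_add[OF sublinear])
      finally show "lowered (x + y) - (p (x + z) - t) \<le> p (y + z') - t'" by simp
    qed
    then show ?thesis by simp
  qed
  from le_lowered[OF this] show "lowered (x + y) \<le> lowered x + lowered y" by simp
next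
  fix c :: real and x assume c: "0 < c"
  have "lowered (c *\<^sub>R x) / c \<le> lowered x"
  proof (rule le_lowered)
    fix z t assume "(z, t) \<in> D"
    then have "lowered (c *\<^sub>R x) \<le> p (c *\<^sub>R x + c *\<^sub>R z) - c * t"
      using c by (intro lowered_le scale_mem)
    also have "p (c *\<^sub>R x + c *\<^sub>R z) = c * p (x + z)"
      using c sublinear_scaleR[OF sublinear, of c "x + z"] by (simp add: scaleR_add_right)
    finally show "lowered (c *\<^sub>R x) / c \<le> p (x + z) - t"
      using c by (simp add: field_simps)
  qed
  then show "lowered (c *\<^sub>R x) \<le> c * lowered x"
    using c by (simp add: field_simps)
next
  have "0 \<le> lowered 0"
    by (rule le_lowered) (use dominated in auto)
  then show "lowered 0 = 0"
    using lowered_le_self[of 0] sublinear_zero[OF sublinear] by simp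
qed

end

text \<open>A minimal sublinear function cannot be lowered, hence is additive.\<close>

lemma sublinear_dominates_linear:
  fixes p :: "'a::real_vector \<Rightarrow> real"
  assumes p: "sublinear p"
  obtains g where "linear g" "\<And>x. g x \<le> p x"
proof -
  define A where "A = {m. sublinear m \<and> m \<le> p}"
  \<comment> \<open>Zorn's lemma is used for \<open>\<ge>\<close>, so the element it yields is
    minimal among the sublinear functions below \<open>p\<close>.\<close>
  have "\<exists>m\<in>A. \<forall>a\<in>A. m \<ge> a \<longrightarrow> a = m"
  proof (rule predicate_Zorn)
    show "partial_order_on A (relation_of (\<ge>) A)"
      by (rule partial_order_on_relation_ofI) auto
  next
    fix C assume C: "C \<in> Chains (relation_of (\<ge>) A)"
    then have CA: "m \<in> A" if "m \<in> C" for m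
      using that by (auto simp: Chains_def relation_of_def)
    have total: "m \<le> m' \<or> m' \<le> m" if "m \<in> C" "m' \<in> C" for m m'
      using C that by (auto simp: Chains_def relation_of_def)
    show "\<exists>u\<in>A. \<forall>a\<in>C. a \<ge> u"
    proof (cases "C = {}")
      case True
      then show ?thesis using p by (auto simp: A_def)
    next
      case False
      define u where "u x = (INF m\<in>C. m x)" for x
      \<comment> \<open>Subadditivity forces \<open>- m (- x) \<le> m x\<close>, so
        \<open>m \<le> p\<close> also yields a lower bound independent of \<open>m\<close>, and the
        infimum over the chain is finite.\<close>
      have bdd: "bdd_below ((\<lambda>m. m x) ` C)" for x
      proof (rule bdd_belowI2)
        fix m assume "m \<in> C"
        then have "- p (- x) \<le> - m (- x)" "sublinear m"
          using CA[of m] by (auto simp: A_def le_fun_def)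
        then show "- p (- x) \<le> m x"
          using sublinear_minus_le[of m x] by simp
      qed
      have u_le: "u x \<le> m x" if "m \<in> C" for m x
        unfolding u_def by (rule cINF_lower[OF bdd that])
      have le_u: "b \<le> u x" if "\<And>m. m \<in> C \<Longrightarrow> b \<le> m x" for b x
        unfolding u_def using False that by (intro cINF_greatest)
      have "sublinear u"
      proof (rule sublinearI)
        fix x y
        have "u (x + y) - u y \<le> m x" if m: "m \<in> C" for m
        proof -
          have "u (x + y) - m x \<le> m' y" if m': "m' \<in> C" for m'
          proof -
            \<comment> \<open>The chain condition enters here: the smaller of \<open>m\<close> and
              \<open>m'\<close> bounds both terms. An infimum of unrelated sublinear functions need
              not be subadditive.\<close>
            obtain k where k: "k \<in> C" "k \<le> m" "k \<le> m'"
              using total[OF m m'] m m' by auto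
            have "u (x + y) \<le> k (x + y)" by (rule u_le[OF k(1)])
            also have "\<dots> \<le> k x + k y"
              using CA[OF k(1)] by (auto simp: A_def intro: sublinear_add)
            also have "\<dots> \<le> m x + m' y"
              using k by (intro add_mono) (auto simp: le_fun_def)
            finally show ?thesis by simp
          qed
          then have "u (x + y) - m x \<le> u y" by (rule le_u)
          then show ?thesis by simp
        qed
        then have "u (x + y) - u y \<le> u x" by (rule le_u)
        then show "u (x + y) \<le> u x + u y" by simp
      next
        fix c :: real and x assume c: "0 < c"
        have "u (c *\<^sub>R x) / c \<le> m x" if m: "m \<in> C" for m
          using u_le[OF m, of "c *\<^sub>R x"] CA[OF m] c sublinear_scaleR[of m c x]
          by (simp add: A_def field_simps)
        from le_u[OF this] show "u (c *\<^sub>R x) \<le> c * u x"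
          using c by (simp add: field_simps)
      next
        have "m 0 = 0" if "m \<in> C" for m
          using CA[OF that] by (auto simp: A_def intro: sublinear_zero)
        with False show "u 0 = 0"
          using le_u[of 0 0] u_le[of _ 0] by (metis antisym_conv equals0I order_refl)
      qed
      moreover have "u \<le> p"
        using False u_le CA by (auto simp: A_def le_fun_def) (meson order_trans)
      ultimately show ?thesis
        using u_le by (auto simp: A_def le_fun_def)
    qed
  qed
  then obtain m where m: "sublinear m" "m \<le> p"
    and minimal: "\<And>k. sublinear k \<Longrightarrow> k \<le> m \<Longrightarrow> k = m"
    unfolding A_def by (auto intro: order_trans)
  \<comment> \<open>Lowering \<open>m\<close> along the ray through \<open>(a, m a)\<close> gives a
    sublinear function below \<open>m\<close>, hence \<open>m\<close> itself; the point
    \<open>s = 1\<close> of the ray gives superadditivity.\<close>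
  have superadd: "m x + m a \<le> m (x + a)" for x a
  proof -
    interpret constrained_sublinear m "(\<lambda>s. s *\<^sub>R (a, m a)) ` {0..}"
      by unfold_locales (use m sublinear_scaleR[OF m(1)] convex_cone_ray[of "(a, m a)"] in auto)
    have "lowered = m"
      using sublinear_lowered lowered_le_self by (intro minimal) (auto simp: le_fun_def)
    moreover have "lowered x \<le> m (x + a) - m a"
      by (rule lowered_le) (auto intro!: image_eqI[of _ _ 1])
    ultimately show ?thesis by simp
  qed
  have add: "m (x + a) = m x + m a" for x a
    using superadd sublinear_add[OF m(1)] by (simp add: antisym)
  have minus: "m (- x) = - m x" for x
    using add[of x "- x"] sublinear_zero[OF m(1)] by simp
  have "linear m"
  proof (rule linearI)
    fix c :: real and x
    show "m (c *\<^sub>R x) = c *\<^sub>R m x"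
    proof (cases "0 \<le> c")
      case False
      then have "m ((- c) *\<^sub>R x) = - c * m x"
        using m(1) by (intro sublinear_scaleR) auto
      then show ?thesis using minus[of "c *\<^sub>R x"] by simp
    qed (simp add: sublinear_scaleR[OF m(1)])
  qed (rule add)
  with m(2) show thesis
    by (intro that) (auto simp: le_fun_def)
qed

text \<open>A linear function below \<open>lowered\<close> lies below \<open>p\<close>, and its
  value at \<open>- z\<close> is at most \<open>p 0 - t\<close>, so it meets each constraint. The
  norming, separating, positive and oscillating functionals below are all instances.\<close>

lemma (in constrained_sublinear) linear_between:
  obtains g where "linear g" "\<And>x. g x \<le> p x" "\<And>z t. (z, t) \<in> D \<Longrightarrow> t \<le> g z"
proof -
  obtain g where g: "linear g" "\<And>x. g x \<le> lowered x"
    using sublinear_dominates_linear[OF sublinear_lowered] by blast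
  have "t \<le> g z" if "(z, t) \<in> D" for z t
  proof -
    have "g (- z) \<le> - t"
      using g(2)[of "- z"] lowered_le[OF that, of "- z"] sublinear_zero[OF sublinear] by simp
    then show ?thesis using linear_neg[OF g(1)] by simp
  qed
  with g show thesis
    by (intro that[of g]) (auto intro: order_trans[OF g(2) lowered_le_self])
qed

lemma linear_le_norm_imp_blinfun:
  fixes g :: "'a::real_normed_vector \<Rightarrow> real"
  assumes g: "linear g" "\<And>x. g x \<le> K * norm x"
  obtains f where "blinfun_apply f = g"
proof -
  have "\<bar>g x\<bar> \<le> norm x * K" for x
    using g(2)[of x] g(2)[of "- x"] linear_neg[OF g(1), of x] by (simp add: abs_le_iff mult.commute)
  then have "bounded_linear g"
    using g(1) by (intro bounded_linear_intro[of g K]) (auto simp: linear_add linear_cmul)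
  then show thesis
    by (intro that[of "Blinfun g"] bounded_linear_Blinfun_apply)
qed

lemma exists_norming_functional:
  fixes x :: "'a::real_normed_vector"
  obtains f :: "'a \<Rightarrow>\<^sub>L real" where "f x = norm x" "\<And>y. \<bar>f y\<bar> \<le> norm y"
proof -
  interpret constrained_sublinear norm "(\<lambda>s. s *\<^sub>R (x, norm x)) ` {0..}"
    by unfold_locales (use sublinear_norm convex_cone_ray[of "(x, norm x)"] in auto)
  obtain g where g: "linear g" "\<And>y. g y \<le> norm y"
    "\<And>z t. (z, t) \<in> (\<lambda>s. s *\<^sub>R (x, norm x)) ` {0..} \<Longrightarrow> t \<le> g z"
    using linear_between by blast
  have "norm x \<le> g x"
    by (rule g(3)) (auto intro!: image_eqI[of _ _ 1])
  moreover obtain f where "blinfun_apply f = g"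
    using linear_le_norm_imp_blinfun[of g 1] g by auto
  moreover have "\<bar>g y\<bar> \<le> norm y" for y
    using g(2)[of y] g(2)[of "- y"] linear_neg[OF g(1), of y] by (simp add: abs_le_iff)
  ultimately show thesis
    using g(2)[of x] by (intro that[of f]) auto
qed

lemma separate_closed_subspace:
  fixes Y :: "'a::real_normed_vector set"
  assumes Y: "closed Y" "subspace Y" and x: "x \<notin> Y"
  obtains f :: "'a \<Rightarrow>\<^sub>L real" where "f x \<noteq> 0" "\<And>y. y \<in> Y \<Longrightarrow> f y = 0"
proof -
  obtain d where d: "d > 0" "\<And>y. y \<in> Y \<Longrightarrow> d \<le> norm (x - y)"
  proof -
    obtain e where "e > 0" "ball x e \<subseteq> - Y"
      using Y(1) x open_contains_ball[of "- Y"] by (auto simp: open_Compl)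
    then show thesis
      by (intro that[of e]) (auto simp: dist_norm subset_iff not_less[symmetric])
  qed
  \<comment> \<open>Generators with \<open>s = 0\<close> demand a value at least \<open>0\<close> at
    \<open>y\<close> and at \<open>- y\<close>, so the functional vanishes on \<open>Y\<close>; the
    point \<open>x\<close> gets a value at least \<open>d\<close>, a lower bound for its distance
    from \<open>Y\<close>.\<close>
  define D where "D = (\<lambda>(s, y). (s *\<^sub>R x + y, s * d)) ` ({0..} \<times> Y)"
  interpret constrained_sublinear norm D
  proof
    show "sublinear (norm :: 'a \<Rightarrow> real)" by (rule sublinear_norm)
    have "linear (\<lambda>(s, y). (s *\<^sub>R x + y, s * d))"
      by (rule linearI) (auto simp: algebra_simps)
    moreover have "convex_cone ({0..} \<times> Y :: (real \<times> 'a) set)"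
      using Y(2) by (auto simp: convex_cone_iff subspace_def zero_prod_def)
    ultimately show "convex_cone D"
      unfolding D_def by (intro convex_cone_linear_image conjI)
  next
    fix z t assume "(z, t) \<in> D"
    then obtain s y where s: "0 \<le> s" "y \<in> Y" "z = s *\<^sub>R x + y" "t = s * d"
      by (auto simp: D_def)
    show "t \<le> norm z"
    proof (cases "s = 0")
      case False
      with s have "d \<le> norm (x - (- 1 / s) *\<^sub>R y)"
        using subspace_scale[OF Y(2)] by (intro d)
      then have "s * d \<le> s * norm (x - (- 1 / s) *\<^sub>R y)"
        using s by (intro mult_left_mono)
      also have "\<dots> = norm (s *\<^sub>R (x - (- 1 / s) *\<^sub>R y))"
        using s by simp
      also have "s *\<^sub>R (x - (- 1 / s) *\<^sub>R y) = z"
        using False s by (simp add: algebra_simps)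
      finally show ?thesis using s by simp
    qed (use s in simp)
  qed
  obtain g where g: "linear g" "\<And>y. g y \<le> norm y" "\<And>z t. (z, t) \<in> D \<Longrightarrow> t \<le> g z"
    using linear_between by blast
  have "d \<le> g x"
    by (rule g(3)) (use subspace_0[OF Y(2)] in \<open>auto simp: D_def intro!: image_eqI[of _ _ "(1, 0)"]\<close>)
  moreover have "0 \<le> g y" if "y \<in> Y" for y
    by (rule g(3)) (use that in \<open>auto simp: D_def intro!: image_eqI[of _ _ "(0, y)"]\<close>)
  then have "g y = 0" if "y \<in> Y" for y
    using that subspace_neg[OF Y(2)] linear_neg[OF g(1)]
    by (metis add.inverse_inverse antisym neg_0_le_iff_le)
  moreover obtain f where "blinfun_apply f = g"
    using linear_le_norm_imp_blinfun[of g 1] g by auto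
  ultimately show thesis
    using d(1) by (intro that[of f]) auto
qed

section \<open>Weak compactness and boundedness\<close>

lemma topspace_weak_topology [simp]: "topspace weak_topology = UNIV"
  by (simp add: weak_topology_def topspace_pullback_topology)

lemma continuous_map_weak_topology:
  "continuous_map X weak_topology g \<longleftrightarrow>
     (\<forall>f :: 'a::real_normed_vector \<Rightarrow>\<^sub>L real. continuous_map X euclideanreal (\<lambda>x. f (g x)))"
proof
  assume g: "continuous_map X weak_topology g"
  show "\<forall>f :: 'a \<Rightarrow>\<^sub>L real. continuous_map X euclideanreal (\<lambda>x. f (g x))"
  proof
    fix f :: "'a \<Rightarrow>\<^sub>L real"
    have "continuous_map euclidean euclideanreal (\<lambda>h :: ('a \<Rightarrow>\<^sub>L real) \<Rightarrow> real. h f)"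
      by (simp add: continuous_on_product_coordinates)
    then have "continuous_map weak_topology euclideanreal
        ((\<lambda>h. h f) \<circ> (\<lambda>x (f :: 'a \<Rightarrow>\<^sub>L real). f x))"
      unfolding weak_topology_def by (rule continuous_map_pullback)
    from continuous_map_compose[OF g this] show "continuous_map X euclideanreal (\<lambda>x. f (g x))"
      by (simp add: o_def)
  qed
next
  assume "\<forall>f :: 'a \<Rightarrow>\<^sub>L real. continuous_map X euclideanreal (\<lambda>x. f (g x))"
  then have "continuous_map X euclidean ((\<lambda>x (f :: 'a \<Rightarrow>\<^sub>L real). f x) \<circ> g)"
    unfolding euclidean_product_topology[symmetric]
    by (simp add: continuous_map_componentwise_UNIV o_def)
  then show "continuous_map X weak_topology g"
    unfolding weak_topology_def by (rule continuous_map_pullback') auto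
qed

lemma openin_weak_topology_preimage:
  fixes f :: "'a::real_normed_vector \<Rightarrow>\<^sub>L real"
  assumes "open V"
  shows "openin weak_topology {x. f x \<in> V}"
proof -
  have "continuous_map weak_topology euclideanreal f"
    using continuous_map_weak_topology[of weak_topology "\<lambda>x :: 'a. x"] by simp
  from openin_continuous_map_preimage[OF this] show ?thesis
    using assms by simp
qed

lemma separating_functional:
  fixes x y :: "'a::real_normed_vector"
  assumes "x \<noteq> y"
  obtains f :: "'a \<Rightarrow>\<^sub>L real" where "f x \<noteq> f y"
proof -
  obtain f :: "'a \<Rightarrow>\<^sub>L real" where f: "f (x - y) = norm (x - y)"
    using exists_norming_functional by blast
  show thesis
    by (rule that[of f]) (use f assms in \<open>auto simp: blinfun.diff_right\<close>)
qed

lemma Hausdorff_weak_topology: "Hausdorff_space (weak_topology :: 'a::real_normed_vector topology)"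
  unfolding Hausdorff_space_def
proof (intro allI impI, elim conjE)
  fix x y :: 'a assume "x \<noteq> y"
  then obtain f :: "'a \<Rightarrow>\<^sub>L real" where f: "f x \<noteq> f y" by (rule separating_functional)
  then obtain U V where "open U" "open V" "f x \<in> U" "f y \<in> V" "U \<inter> V = {}"
    using hausdorff[OF f] by auto
  then show "\<exists>U V. openin weak_topology U \<and> openin weak_topology V \<and> x \<in> U \<and> y \<in> V \<and> disjnt U V"
    by (intro exI[of _ "{z. f z \<in> U}"] exI[of _ "{z. f z \<in> V}"])
       (auto simp: openin_weak_topology_preimage disjnt_def)
qed

section \<open>Sequences in weakly compact sets (Eberlein-Smulian)\<close>

lemma compactin_sequence_cluster_point:
  assumes K: "compactin X K" and y: "\<And>n::nat. y n \<in> K"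
  obtains c where "c \<in> K" "\<And>U. openin X U \<Longrightarrow> c \<in> U \<Longrightarrow> \<exists>\<^sub>F n in sequentially. y n \<in> U"
proof (rule ccontr)
  assume "\<not> thesis"
  then have "\<forall>c\<in>K. \<exists>U. openin X U \<and> c \<in> U \<and> (\<forall>\<^sub>F n in sequentially. y n \<notin> U)"
    using that by (force simp: not_frequently)
  then obtain U where U: "\<And>c. c \<in> K \<Longrightarrow> openin X (U c) \<and> c \<in> U c \<and> (\<forall>\<^sub>F n in sequentially. y n \<notin> U c)"
    by metis
  have "\<exists>\<F>. finite \<F> \<and> \<F> \<subseteq> U ` K \<and> K \<subseteq> \<Union>\<F>"
    using K U by (intro compactinD[OF K]) auto
  then obtain F where F: "finite F" "F \<subseteq> K" "K \<subseteq> \<Union>(U ` F)"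
    by (metis finite_subset_image)
  \<comment> \<open>Finitely many of the \<open>U c\<close> cover \<open>K\<close>, and each is
    eventually avoided, so eventually \<open>y n\<close> would lie outside \<open>K\<close>.\<close>
  have "\<forall>\<^sub>F n in sequentially. \<forall>c\<in>F. y n \<notin> U c"
    using F U by (intro eventually_ball_finite) auto
  then have "\<forall>\<^sub>F n in sequentially. False"
    by (rule eventually_mono) (use F y in blast)
  then show False by simp
qed

text \<open>A functional norming \<open>d\<close> detects every \<open>z\<close> that is close to
  \<open>d\<close> relative to \<open>norm z\<close>, so functionals norming a dense set separate
  points.\<close>

lemma norming_functional_near:
  fixes f :: "'a::real_normed_vector \<Rightarrow>\<^sub>L real"
  assumes "f d = norm d" "\<And>y. \<bar>f y\<bar> \<le> norm y" "2 * norm (z - d) < norm z"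
  shows "f z \<noteq> 0"
proof -
  have "norm d - norm (z - d) \<le> f d + f (z - d)"
    using assms(1) assms(2)[of "z - d"] by (simp add: abs_le_iff)
  also have "\<dots> = f z"
    by (simp add: blinfun.diff_right)
  finally have "norm d - norm (z - d) \<le> f z" .
  moreover have "norm z \<le> norm d + norm (z - d)"
    using norm_triangle_ineq[of d "z - d"] by simp
  ultimately show ?thesis using assms(3) by linarith
qed

text \<open>The weak topology need not be metrizable, so sequential arguments require countably many
  functionals. The closed span of \<open>y\<close> is separable, and functionals norming a countable
  dense subset separate its points.\<close>

lemma separable_subspace:
  fixes y :: "nat \<Rightarrow> 'a::real_normed_vector"
  obtains Y and f :: "nat \<Rightarrow> 'a \<Rightarrow>\<^sub>L real" where "closed Y" "subspace Y" "range y \<subseteq> Y"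
    "\<And>z. z \<in> Y \<Longrightarrow> (\<And>k. f k z = 0) \<Longrightarrow> z = 0" "\<And>k z. \<bar>f k z\<bar> \<le> norm z"
proof -
  \<comment> \<open>Lists encode the rational combinations, so that \<open>from_nat\<close> and
    \<open>to_nat\<close> index them; concatenation is addition.\<close>
  define ev where "ev qs = (\<Sum>(q, i)\<leftarrow>qs. real_of_rat q *\<^sub>R y i)" for qs :: "(rat \<times> nat) list"
  define Y where "Y = closure (range ev)"
  have ev_in: "ev qs \<in> Y" for qs
    unfolding Y_def by (rule subsetD[OF closure_subset]) simp
  have ev_add: "ev (qs @ rs) = ev qs + ev rs" for qs rs
    by (simp add: ev_def)
  have ev_scale: "ev (map (map_prod ((*) q) id) qs) = real_of_rat q *\<^sub>R ev qs" for q qs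
    by (induction qs) (auto simp: ev_def of_rat_mult scaleR_add_right)
  have subspace: "subspace Y"
    unfolding subspace_def
  proof (intro conjI ballI allI)
    show "0 \<in> Y"
      using ev_in[of "[]"] by (simp add: ev_def)
  next
    fix u v assume "u \<in> Y" "v \<in> Y"
    then obtain a b where "\<And>n. a n \<in> range ev" "a \<longlonglongrightarrow> u" "\<And>n. b n \<in> range ev" "b \<longlonglongrightarrow> v"
      unfolding Y_def closure_sequential by blast
    moreover have "a n + b n \<in> range ev" for n
    proof -
      obtain qs rs where "a n = ev qs" "b n = ev rs"
        using calculation(1)[of n] calculation(3)[of n] by blast
      then show ?thesis
        using ev_add[of qs rs] by (metis rangeI)
    qed
    ultimately show "u + v \<in> Y"
      unfolding Y_def closure_sequential
      by (intro exI[of _ "\<lambda>n. a n + b n"]) (auto intro: tendsto_add)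
  next
    fix c :: real and u assume "u \<in> Y"
    then obtain a where a: "\<And>n. a n \<in> range ev" "a \<longlonglongrightarrow> u"
      unfolding Y_def closure_sequential by blast
    obtain q where q: "\<And>n. q n \<in> \<rat>" "q \<longlonglongrightarrow> c"
    proof -
      have "c \<in> closure \<rat>" by (simp add: Rats_closure_real)
      then show thesis unfolding closure_sequential using that by blast
    qed
    have "q n *\<^sub>R a n \<in> range ev" for n
    proof -
      obtain q' qs where "q n = real_of_rat q'" "a n = ev qs"
        using q(1)[of n] a(1)[of n] by (auto elim!: Rats_cases)
      then show ?thesis
        using ev_scale[of q' qs] by (metis rangeI)
    qed
    then show "c *\<^sub>R u \<in> Y"
      unfolding Y_def closure_sequential
      using a q by (intro exI[of _ "\<lambda>n. q n *\<^sub>R a n"]) (auto intro: tendsto_scaleR)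
  qed
  have "y i \<in> Y" for i
  proof -
    show ?thesis using ev_in[of "[(1, i)]"] by (simp add: ev_def)
  qed
  have "\<exists>f :: 'a \<Rightarrow>\<^sub>L real. f x = norm x \<and> (\<forall>z. \<bar>f z\<bar> \<le> norm z)" for x
    by (rule exists_norming_functional[of x]) blast
  then have "\<forall>k. \<exists>f :: 'a \<Rightarrow>\<^sub>L real. f (ev (from_nat k)) = norm (ev (from_nat k)) \<and> (\<forall>z. \<bar>f z\<bar> \<le> norm z)"
    by blast
  from choice[OF this] obtain f :: "nat \<Rightarrow> 'a \<Rightarrow>\<^sub>L real"
    where f: "\<And>k. f k (ev (from_nat k)) = norm (ev (from_nat k))" "\<And>k z. \<bar>f k z\<bar> \<le> norm z"
    by blast
  show thesis
  proof (rule that[of Y f])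
    fix z assume z: "z \<in> Y" "\<And>k. f k z = 0"
    show "z = 0"
    proof (rule ccontr)
      assume "z \<noteq> 0"
      then have "0 < norm z / 2" by simp
      with z(1) obtain qs where "dist (ev qs) z < norm z / 2"
        unfolding Y_def closure_approachable by blast
      then have "2 * norm (z - ev qs) < norm z"
        by (simp add: dist_norm norm_minus_commute)
      with norming_functional_near[of "f (to_nat qs)" "ev qs" z] f[of "to_nat qs"] z(2)
      show False by simp
    qed
  qed (use subspace \<open>\<And>i. y i \<in> Y\<close> f(2) in \<open>auto simp: Y_def\<close>)
qed

text \<open>A countable product of compact intervals is compact and first countable, hence
  sequentially compact; this replaces a diagonal argument.\<close>

lemma coordinatewise_convergent_subseq:
  fixes x :: "nat \<Rightarrow> nat \<Rightarrow> real"
  assumes "\<And>n k. \<bar>x n k\<bar> \<le> B k"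
  obtains r :: "nat \<Rightarrow> nat" and a where "strict_mono r" "\<And>k. (\<lambda>n. x (r n) k) \<longlonglongrightarrow> a k"
proof -
  have "compactin (product_topology (\<lambda>k. euclideanreal) UNIV) (Pi\<^sub>E UNIV (\<lambda>k. {- B k..B k}))"
    by (simp add: compactin_PiE)
  then have "compact (Pi\<^sub>E UNIV (\<lambda>k. {- B k..B k}))"
    by (simp add: euclidean_product_topology)
  then have "seq_compact (Pi\<^sub>E UNIV (\<lambda>k. {- B k..B k}))"
    by (rule compact_imp_seq_compact)
  moreover have "x n \<in> Pi\<^sub>E UNIV (\<lambda>k. {- B k..B k})" for n
    using assms[of n] by (auto simp: abs_le_iff minus_le_iff)
  ultimately obtain a r where r: "strict_mono r" "(x \<circ> r) \<longlonglongrightarrow> a"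
    unfolding seq_compact_def by blast
  have "(\<lambda>n. x (r n) k) \<longlonglongrightarrow> a k" for k
  proof -
    have "continuous_on UNIV (\<lambda>v :: nat \<Rightarrow> real. v k)"
      by (rule continuous_on_product_coordinates)
    from continuous_on_tendsto_compose[OF this r(2)] show ?thesis
      by (simp add: o_def)
  qed
  with r(1) show thesis by (rule that)
qed

text \<open>\<open>f\<close> is weakly continuous, so \<open>f c\<close> is a cluster value of
  \<open>f (y n)\<close>; a convergent real sequence has no cluster value but its limit.\<close>

lemma frequently_limit_eq:
  fixes f :: "'a::real_normed_vector \<Rightarrow>\<^sub>L real"
  assumes c: "\<And>U. openin weak_topology U \<Longrightarrow> c \<in> U \<Longrightarrow> \<exists>\<^sub>F n in sequentially. y n \<in> U"
    and a: "(\<lambda>n. f (y n)) \<longlonglongrightarrow> a"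
  shows "f c = a"
proof (rule ccontr)
  assume ne: "f c \<noteq> a"
  then obtain U V where UV: "open U" "open V" "f c \<in> U" "a \<in> V" "U \<inter> V = {}"
    using hausdorff[OF ne] by auto
  have "\<exists>\<^sub>F n in sequentially. y n \<in> {x. f x \<in> U}"
    using UV by (intro c openin_weak_topology_preimage) auto
  moreover have "\<forall>\<^sub>F n in sequentially. f (y n) \<in> V"
    using a UV by (auto simp: tendsto_def)
  ultimately have "\<exists>\<^sub>F n in sequentially. y n \<in> {x. f x \<in> U} \<and> f (y n) \<in> V"
    by (rule frequently_eventually_frequently)
  then have "\<exists>\<^sub>F n in sequentially. False"
    by (rule frequently_elim1) (use UV(5) in auto)
  then show False by simp
qed

text \<open>Compactness gives only cluster points. Along a subsequence on which all
  \<open>f k\<close> converge, any two of them agree under every \<open>f k\<close> and lie in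
  \<open>Y\<close>, hence coincide; uniqueness of the cluster point then gives convergence.\<close>

theorem weakly_compact_imp_weakly_convergent_subseq:
  fixes y :: "nat \<Rightarrow> 'a::real_normed_vector"
  assumes K: "compactin weak_topology K" and y: "\<And>n. y n \<in> K"
    and bounded: "\<And>n. norm (y n) \<le> B"
  obtains r l where "strict_mono r" "weakly_tendsto (\<lambda>n. y (r n)) l"
proof -
  obtain Y and f :: "nat \<Rightarrow> 'a \<Rightarrow>\<^sub>L real" where Y: "closed Y" "subspace Y" "range y \<subseteq> Y"
    and f: "\<And>z. z \<in> Y \<Longrightarrow> (\<And>k. f k z = 0) \<Longrightarrow> z = 0" "\<And>k z. \<bar>f k z\<bar> \<le> norm z"
    by (rule separable_subspace[of y]) blast
  have "\<bar>f k (y n)\<bar> \<le> B" for n k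
    using f(2) bounded by (rule order_trans)
  then obtain r :: "nat \<Rightarrow> nat" and a where r: "strict_mono r"
    and a: "\<And>k. (\<lambda>n. f k (y (r n))) \<longlonglongrightarrow> a k"
    by (rule coordinatewise_convergent_subseq[of "\<lambda>n k. f k (y n)" "\<lambda>_. B"]) blast
  \<comment> \<open>\<open>Y\<close> is weakly closed: a functional vanishing on \<open>Y\<close>
    separates it from any point outside.\<close>
  have in_Y: "c \<in> Y"
    if c: "\<And>U. openin weak_topology U \<Longrightarrow> c \<in> U \<Longrightarrow> \<exists>\<^sub>F n in sequentially. y (s n) \<in> U" for c s
  proof (rule ccontr)
    assume "c \<notin> Y"
    from separate_closed_subspace[OF Y(1,2) this] obtain g :: "'a \<Rightarrow>\<^sub>L real"
      where g: "g c \<noteq> 0" "\<And>y. y \<in> Y \<Longrightarrow> g y = 0"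
      by blast
    then have "(\<lambda>n. g (y (s n))) \<longlonglongrightarrow> 0"
      using Y(3) by (simp add: image_subset_iff)
    from frequently_limit_eq[OF c this] g(1) show False by simp
  qed
  have "y (r n) \<in> K" for n by (rule y)
  then obtain c where c: "c \<in> K"
    "\<And>U. openin weak_topology U \<Longrightarrow> c \<in> U \<Longrightarrow> \<exists>\<^sub>F n in sequentially. y (r n) \<in> U"
    by (rule compactin_sequence_cluster_point[OF K, of "\<lambda>n. y (r n)"]) blast
  have "weakly_tendsto (\<lambda>n. y (r n)) c"
    unfolding weakly_tendsto_def limitin_def
  proof (intro conjI allI impI, simp)
    fix U assume "openin weak_topology U \<and> c \<in> U"
    then have U: "openin weak_topology U" "c \<in> U" by auto
    show "\<forall>\<^sub>F n in sequentially. y (r n) \<in> U"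
    proof (rule ccontr)
      assume "\<not> ?thesis"
      then have "infinite {n. y (r n) \<notin> U}"
        by (simp add: not_eventually frequently_cofinite flip: cofinite_eq_sequentially)
      then obtain t :: "nat \<Rightarrow> nat" where t: "strict_mono t" "\<And>n. y (r (t n)) \<notin> U"
        using infinite_enumerate[of "{n. y (r n) \<notin> U}"] by auto
      \<comment> \<open>Terms outside \<open>U\<close> cluster at a point \<open>c'\<close> of this
        compact set, yet \<open>c'\<close> must equal \<open>c\<close>, which lies in
        \<open>U\<close>.\<close>
      have "compactin weak_topology (K \<inter> - U)"
        using U(1) by (intro compact_Int_closedin[OF K]) (simp add: closedin_def Compl_eq_Diff_UNIV[symmetric])
      moreover have "y (r (t n)) \<in> K \<inter> - U" for n
        using y t(2) by simp
      ultimately obtain c' where c': "c' \<in> K \<inter> - U"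
        "\<And>U. openin weak_topology U \<Longrightarrow> c' \<in> U \<Longrightarrow> \<exists>\<^sub>F n in sequentially. y (r (t n)) \<in> U"
        by (rule compactin_sequence_cluster_point[of weak_topology "K \<inter> - U" "\<lambda>n. y (r (t n))"]) blast
      have "f k (c - c') = 0" for k
      proof -
        have "(\<lambda>n. f k (y (r (t n)))) \<longlonglongrightarrow> a k"
          using LIMSEQ_subseq_LIMSEQ[OF a[of k] t(1)] by (simp add: o_def)
        from frequently_limit_eq[OF c'(2) this] have "f k c' = a k" .
        moreover have "f k c = a k"
          by (rule frequently_limit_eq[OF c(2) a])
        ultimately show ?thesis by (simp add: blinfun.diff_right)
      qed
      moreover have "c - c' \<in> Y"
        using in_Y[OF c(2)] in_Y[of c' "\<lambda>n. r (t n)", OF c'(2)] Y(2) by (simp add: subspace_diff)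
      ultimately have "c - c' = 0" using f(1) by blast
      with c'(1) U(2) show False by simp
    qed
  qed
  with r show thesis by (rule that)
qed

text \<open>Banach-Steinhaus for evaluations: the dual is complete even if \<open>'a\<close> is not,
  so Baire's theorem finds a ball of functionals bounded by one \<open>m\<close> along the whole
  sequence.\<close>

lemma weakly_bounded_imp_bounded:
  fixes x :: "nat \<Rightarrow> 'a::real_normed_vector"
  assumes "\<And>f :: 'a \<Rightarrow>\<^sub>L real. bounded (range (\<lambda>n. f (x n)))"
  shows "bounded (range x)"
proof -
  define F where "F m = {f :: 'a \<Rightarrow>\<^sub>L real. \<forall>n. \<bar>f (x n)\<bar> \<le> real m}" for m
  have closed_F: "closed (F m)" for m
    unfolding F_def by (intro closed_Collect_all closed_Collect_le continuous_intros)
  have "\<exists>m. interior (F m) \<noteq> {}"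
  proof (rule ccontr)
    assume "\<nexists>m. interior (F m) \<noteq> {}"
    then have dense: "closure (- F m) = UNIV" for m
      by (simp add: closure_complement)
    have "Met_TC.mtopology closure_of \<Inter>(range (\<lambda>m. - F m)) = UNIV"
      by (rule Met_TC.metric_Baire_category)
         (auto simp: mcomplete_iff_complete complete_UNIV open_Compl closed_F dense)
    then have "closure (\<Inter>(range (\<lambda>m. - F m))) = UNIV"
      by simp
    then have "\<Inter>(range (\<lambda>m. - F m)) \<noteq> {}"
      by (metis UNIV_not_empty closure_empty subset_empty)
    then obtain f :: "'a \<Rightarrow>\<^sub>L real" where f: "\<And>m. f \<notin> F m"
      by auto
    obtain B where "\<And>n. \<bar>f (x n)\<bar> \<le> B"
      using assms[of f] by (auto simp: bounded_iff)
    then have "f \<in> F (nat \<lceil>B\<rceil>)"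
      using order_trans[OF _ real_nat_ceiling_ge] by (simp add: F_def)
    with f show False by blast
  qed
  then obtain m f0 where "f0 \<in> interior (F m)" by blast
  then obtain e where e: "e > 0" "cball f0 e \<subseteq> F m"
    by (auto simp: mem_interior_cball)
  have "norm (x n) \<le> 2 * real m / e" for n
  proof -
    obtain f :: "'a \<Rightarrow>\<^sub>L real" where f: "f (x n) = norm (x n)" "\<And>y. \<bar>f y\<bar> \<le> norm y"
      by (rule exists_norming_functional[of "x n"]) blast
    have "norm f \<le> 1"
      using f(2) by (intro norm_blinfun_bound) auto
    \<comment> \<open>Both \<open>f0\<close> and \<open>f0 + e *\<^sub>R f\<close> are bounded by
      \<open>m\<close> at \<open>x n\<close>; subtracting isolates
      \<open>e * norm (x n)\<close>.\<close>
    then have "f0 + e *\<^sub>R f \<in> cball f0 e" "f0 \<in> cball f0 e"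
      using e(1) by (auto simp: dist_norm mult_left_le)
    then have "\<bar>f0 (x n) + e * f (x n)\<bar> \<le> m" "\<bar>f0 (x n)\<bar> \<le> m"
      using e(2) by (auto simp: F_def plus_blinfun.rep_eq scaleR_blinfun.rep_eq subset_iff)
    then have "e * norm (x n) \<le> 2 * real m" unfolding f(1) by linarith
    then show ?thesis using e(1) by (simp add: field_simps)
  qed
  then show ?thesis by (auto simp: bounded_iff)
qed

lemma weakly_tendsto_imp_bounded:
  assumes "weakly_tendsto x l"
  shows "bounded (range x)"
proof (rule weakly_bounded_imp_bounded)
  fix f :: "'a \<Rightarrow>\<^sub>L real"
  have "(\<lambda>n. f (x n)) \<longlonglongrightarrow> f l"
    using assms by (simp add: weakly_tendsto_iff)
  then show "bounded (range (\<lambda>n. f (x n)))"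
    by (rule convergent_imp_bounded)
qed

section \<open>Weak and unbounded convergence in Banach lattices\<close>

lemma scaleR_left_le_iff:
  fixes x y :: "'e::ordered_real_vector"
  assumes "0 < c"
  shows "c *\<^sub>R x \<le> y \<longleftrightarrow> x \<le> y /\<^sub>R c"
  using assms scaleR_left_mono[of "c *\<^sub>R x" y "inverse c"] scaleR_left_mono[of x "y /\<^sub>R c" c]
  by auto

text \<open>The class ties positive scaling to the order, not to the modulus. One inequality, used
  for \<open>c\<close> and for \<open>inverse c\<close>, gives homogeneity.\<close>

lemma abs_scaleR_nonneg:
  fixes x :: "'e::banach_lattice"
  assumes "0 \<le> c"
  shows "\<bar>c *\<^sub>R x\<bar> = c *\<^sub>R \<bar>x\<bar>"
proof (cases "c = 0")
  case False
  with assms have c: "0 < c" by simp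
  have le: "\<bar>a *\<^sub>R v\<bar> \<le> a *\<^sub>R \<bar>v\<bar>" if "0 \<le> a" for a and v :: 'e
    using scaleR_left_mono[OF abs_ge_self that, of v] scaleR_left_mono[OF abs_ge_minus_self that, of v]
    by (intro abs_leI) auto
  have "\<bar>x\<bar> \<le> \<bar>c *\<^sub>R x\<bar> /\<^sub>R c"
    using le[of "inverse c" "c *\<^sub>R x"] c by simp
  then have "c *\<^sub>R \<bar>x\<bar> \<le> \<bar>c *\<^sub>R x\<bar>"
    using c by (simp add: scaleR_left_le_iff)
  with le[OF assms] show ?thesis by (rule antisym)
qed simp

lemma inf_scaleR_le:
  fixes x y :: "'e::banach_lattice"
  assumes "0 \<le> c"
  shows "inf (c *\<^sub>R x) (c *\<^sub>R y) \<le> c *\<^sub>R inf x y"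
proof (cases "c = 0")
  case False
  with assms have c: "0 < inverse c" by simp
  have "inverse c *\<^sub>R inf (c *\<^sub>R x) (c *\<^sub>R y) \<le> inf x y"
    using c scaleR_left_le_iff[OF c, of "inf (c *\<^sub>R x) (c *\<^sub>R y)"] by simp
  then show ?thesis
    using scaleR_left_le_iff[OF c, of "inf (c *\<^sub>R x) (c *\<^sub>R y)" "inf x y"] by simp
qed simp

lemma norm_le_norm_of_nonneg:
  fixes x y :: "'e::banach_lattice"
  assumes "0 \<le> x" "x \<le> y"
  shows "norm x \<le> norm y"
  using assms by (intro norm_mono_abs) (simp add: abs_of_nonneg order_trans[OF assms])

lemma norm_abs_eq: "norm \<bar>x\<bar> = norm x" for x :: "'e::banach_lattice"
  by (rule antisym; rule norm_mono_abs; simp)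

text \<open>For disjoint elements the infimum vanishes and the modulus is additive; in general it
  measures the defect. Distributing the two infima leaves bounds by \<open>\<bar>x + y\<bar>\<close>
  plus two moduli, each a triangle inequality.\<close>

lemma abs_add_abs_le:
  fixes x y :: "'e::banach_lattice"
  shows "\<bar>x\<bar> + \<bar>y\<bar> \<le> \<bar>x + y\<bar> + (inf \<bar>x\<bar> \<bar>y\<bar> + inf \<bar>x\<bar> \<bar>y\<bar>)"
proof -
  have x: "\<bar>x\<bar> \<le> \<bar>x + y\<bar> + \<bar>y\<bar>"
    using abs_triangle_ineq[of "x + y" "- y"] by simp
  have y: "\<bar>y\<bar> \<le> \<bar>x + y\<bar> + \<bar>x\<bar>"
    using abs_triangle_ineq[of "x + y" "- x"] by simp
  have "\<bar>x\<bar> + \<bar>y\<bar> \<le> \<bar>x + y\<bar> + (\<bar>x\<bar> + \<bar>x\<bar>)"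
    using add_left_mono[OF y, of "\<bar>x\<bar>"] by (simp add: algebra_simps)
  moreover have "\<bar>x\<bar> + \<bar>y\<bar> \<le> \<bar>x + y\<bar> + (\<bar>y\<bar> + \<bar>y\<bar>)"
    using add_right_mono[OF x, of "\<bar>y\<bar>"] by (simp add: algebra_simps)
  moreover have "\<bar>x\<bar> + \<bar>y\<bar> \<le> \<bar>x + y\<bar> + (\<bar>x\<bar> + \<bar>y\<bar>)"
    by simp
  ultimately show ?thesis
    by (simp add: add_inf_distrib_left add_inf_distrib_right add.commute)
qed

section \<open>Positive functionals as tests for weak nullity\<close>

definition positive_functional :: "('e::banach_lattice \<Rightarrow>\<^sub>L real) \<Rightarrow> bool" where
  "positive_functional h \<longleftrightarrow> (\<forall>x\<ge>0. 0 \<le> h x)"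

lemma positive_functional_nonneg: "positive_functional h \<Longrightarrow> 0 \<le> x \<Longrightarrow> 0 \<le> h x"
  by (simp add: positive_functional_def)

lemma positive_functional_mono:
  assumes "positive_functional h" "x \<le> y"
  shows "h x \<le> h y"
  using positive_functional_nonneg[OF assms(1), of "y - x"] assms(2) by (simp add: blinfun.diff_right)

text \<open>The constraints follow the Riesz-Kantorovich formula for the positive part of
  \<open>f\<close>, the supremum of \<open>f y\<close> over \<open>0 \<le> y \<le> z\<close>. Taking
  \<open>y = 0\<close> makes the functional positive, \<open>y = z\<close> makes it dominate
  \<open>f\<close>.\<close>

lemma exists_positive_upper_bound:
  fixes f :: "'e::banach_lattice \<Rightarrow>\<^sub>L real"
  obtains g where "positive_functional g" "\<And>z. 0 \<le> z \<Longrightarrow> f z \<le> g z"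
proof -
  define D where "D = {(z, f y) | y z. 0 \<le> y \<and> y \<le> z}"
  interpret constrained_sublinear "\<lambda>x. norm f * norm x" D
  proof
    show "sublinear (\<lambda>x. norm f * norm x)"
      by (auto simp: sublinear_def norm_triangle_ineq mult_left_mono simp flip: distrib_left)
    show "convex_cone D"
      unfolding convex_cone_iff
    proof (intro conjI ballI allI impI)
      have "(0, f 0) \<in> D" unfolding D_def by blast
      then show "0 \<in> D" by (simp add: zero_prod_def)
    next
      fix a b assume "a \<in> D" "b \<in> D"
      then obtain y z y' z' where "a = (z, f y)" "0 \<le> y" "y \<le> z" "b = (z', f y')" "0 \<le> y'" "y' \<le> z'"
        by (auto simp: D_def)
      moreover from this have "(z + z', f (y + y')) \<in> D"
        unfolding D_def by (auto intro: add_mono)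
      ultimately show "a + b \<in> D" by (simp add: blinfun.add_right)
    next
      fix a and c :: real assume "a \<in> D" "0 \<le> c"
      then obtain y z where "a = (z, f y)" "0 \<le> y" "y \<le> z"
        by (auto simp: D_def)
      moreover from this \<open>0 \<le> c\<close> have "(c *\<^sub>R z, f (c *\<^sub>R y)) \<in> D"
        unfolding D_def by (auto intro!: exI[of _ "c *\<^sub>R y"] scaleR_left_mono scaleR_nonneg_nonneg)
      ultimately show "c *\<^sub>R a \<in> D" by (simp add: blinfun.scaleR_right)
    qed
  next
    fix z t assume "(z, t) \<in> D"
    then obtain y where y: "t = f y" "0 \<le> y" "y \<le> z" by (auto simp: D_def)
    have "f y \<le> norm f * norm y"
      using norm_blinfun[of f y] by (simp add: abs_le_iff)
    also have "\<dots> \<le> norm f * norm z"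
      using y by (intro mult_left_mono norm_le_norm_of_nonneg) auto
    finally show "t \<le> norm f * norm z" using y by simp
  qed
  obtain g where g: "linear g" "\<And>x. g x \<le> norm f * norm x" "\<And>z t. (z, t) \<in> D \<Longrightarrow> t \<le> g z"
    by (rule linear_between) blast
  obtain g' where g': "blinfun_apply g' = g"
    by (rule linear_le_norm_imp_blinfun[OF g(1,2)])
  show thesis
  proof (rule that[of g'])
    have "f 0 \<le> g z" if "0 \<le> z" for z
      by (rule g(3)) (use that in \<open>unfold D_def, blast\<close>)
    then show "positive_functional g'"
      by (simp add: positive_functional_def g')
    show "f z \<le> g' z" if "0 \<le> z" for z
      unfolding g' by (rule g(3)) (use that in \<open>unfold D_def, blast\<close>)
  qed
qed

text \<open>With \<open>g\<close> above \<open>f\<close> and \<open>k\<close> above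
  \<open>- f\<close> on the positive cone, splitting \<open>x\<close> into its positive and negative
  parts bounds \<open>f x\<close> by \<open>(g + k) \<bar>x\<bar>\<close>. Weak nullity thus follows
  from testing moduli against positive functionals.\<close>

lemma exists_positive_domination:
  fixes f :: "'e::banach_lattice \<Rightarrow>\<^sub>L real"
  obtains h where "positive_functional h" "\<And>x. \<bar>f x\<bar> \<le> h \<bar>x\<bar>"
proof -
  obtain g where g: "positive_functional g" "\<And>z. 0 \<le> z \<Longrightarrow> f z \<le> g z"
    by (rule exists_positive_upper_bound[of f]) blast
  obtain k where k: "positive_functional k" "\<And>z. 0 \<le> z \<Longrightarrow> (- f) z \<le> k z"
    by (rule exists_positive_upper_bound[of "- f"]) blast
  have le: "f x \<le> (g + k) \<bar>x\<bar>" for x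
  proof -
    have "f x = f (pprt x) + (- f) (- nprt x)"
      by (subst prts[of x]) (simp add: blinfun.add_right blinfun.minus_right uminus_blinfun.rep_eq)
    also have "\<dots> \<le> g (pprt x) + k (- nprt x)"
      by (intro add_mono g k) auto
    also have "\<dots> \<le> g \<bar>x\<bar> + k \<bar>x\<bar>"
    proof (intro add_mono positive_functional_mono g k)
      show "pprt x \<le> \<bar>x\<bar>" "- nprt x \<le> \<bar>x\<bar>"
        by (simp_all add: abs_prts)
    qed
    finally show ?thesis by (simp add: plus_blinfun.rep_eq)
  qed
  show thesis
  proof (rule that)
    show "positive_functional (g + k)"
      using g(1) k(1) by (simp add: positive_functional_def plus_blinfun.rep_eq)
    show "\<bar>f x\<bar> \<le> (g + k) \<bar>x\<bar>" for x
      using le[of x] le[of "- x"] by (simp add: blinfun.minus_right abs_le_iff)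
  qed
qed

lemma weakly_tendsto_0_if_positive:
  fixes s :: "nat \<Rightarrow> 'e::banach_lattice"
  assumes "\<And>h. positive_functional h \<Longrightarrow> (\<lambda>n. h \<bar>s n\<bar>) \<longlonglongrightarrow> 0"
  shows "weakly_tendsto s 0"
  unfolding weakly_tendsto_iff
proof
  fix f :: "'e \<Rightarrow>\<^sub>L real"
  obtain h where h: "positive_functional h" "\<And>x. \<bar>f x\<bar> \<le> h \<bar>x\<bar>"
    by (rule exists_positive_domination) blast
  have "(\<lambda>n. f (s n)) \<longlonglongrightarrow> 0"
    by (rule Lim_null_comparison[OF _ assms[OF h(1)]]) (simp add: h(2))
  then show "(\<lambda>n. f (s n)) \<longlonglongrightarrow> f 0" by (simp add: blinfun.zero_right)
qed

lemma weakly_tendsto_0_dominated: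
  fixes s :: "nat \<Rightarrow> 'e::banach_lattice"
  assumes t: "weakly_tendsto t 0" and st: "\<And>n. \<bar>s n\<bar> \<le> t n"
  shows "weakly_tendsto s 0"
proof (rule weakly_tendsto_0_if_positive)
  fix h :: "'e \<Rightarrow>\<^sub>L real" assume h: "positive_functional h"
  have "(\<lambda>n. h (t n)) \<longlonglongrightarrow> 0"
    using t by (simp add: weakly_tendsto_iff blinfun.zero_right)
  then show "(\<lambda>n. h \<bar>s n\<bar>) \<longlonglongrightarrow> 0"
    by (rule Lim_null_comparison[rotated])
       (simp add: positive_functional_nonneg[OF h] positive_functional_mono[OF h st])
qed

section \<open>Almost disjoint subsequences and functionals that oscillate on them\<close>

lemma almost_disjoint_subseq:
  fixes w :: "nat \<Rightarrow> 'e::banach_lattice" and h :: "'e \<Rightarrow>\<^sub>L real"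
  assumes w: "\<And>n. 0 \<le> w n"
    and null: "\<And>u. 0 \<le> u \<Longrightarrow> (\<lambda>n. h (inf (w n) u)) \<longlonglongrightarrow> 0"
    and \<eta>: "\<And>k. 0 < \<eta> k"
  obtains r :: "nat \<Rightarrow> nat" where "strict_mono r"
    "\<And>k. h (inf (\<Sum>i<k. w (r i)) (w (r k))) \<le> \<eta> k"
proof -
  \<comment> \<open>In the recursion \<open>u\<close> is the sum of the elements chosen so far, a
    fixed positive element, so \<open>null\<close> makes all late \<open>w n'\<close> almost
    disjoint from it.\<close>
  have next_index: "\<exists>n'>n. h (inf u (w n')) \<le> \<eta> k" if u: "0 \<le> u" for n u k
  proof -
    have "\<forall>\<^sub>F n' in sequentially. h (inf (w n') u) < \<eta> k"
      using null[OF u] \<eta> by (rule order_tendstoD)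
    moreover have "\<forall>\<^sub>F n' in sequentially. n < n'"
      by (rule eventually_gt_at_top)
    ultimately have "\<forall>\<^sub>F n' in sequentially. n < n' \<and> h (inf u (w n')) \<le> \<eta> k"
      by eventually_elim (simp add: inf.commute)
    then show ?thesis
      by (auto simp: eventually_sequentially)
  qed
  \<comment> \<open>The state pairs the current index with the sum of the earlier elements; the
    clause for \<open>k = 0\<close> starts it at the empty sum.\<close>
  define P where "P k = (\<lambda>(n, u). 0 \<le> u \<and> (k = 0 \<longrightarrow> u = 0) \<and> h (inf u (w n)) \<le> \<eta> k)" for k :: nat
  define Q where "Q = (\<lambda>(k::nat) (n, u) (n', u'). n < n' \<and> u' = u + w n)"
  have "\<exists>f. \<forall>k. P k (f k) \<and> Q k (f k) (f (Suc k))"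
  proof (rule dependent_nat_choice)
    show "\<exists>x. P 0 x"
      using next_index[of 0 0 0] by (auto simp: P_def)
  next
    fix x and k :: nat assume x: "P k x"
    obtain n u where nu: "x = (n, u)" by fastforce
    with x have u: "0 \<le> u + w n" using w[of n] by (simp add: P_def)
    obtain n' where "n < n'" "h (inf (u + w n) (w n')) \<le> \<eta> (Suc k)"
      using next_index[OF u] by blast
    with u nu show "\<exists>y. P (Suc k) y \<and> Q k x y"
      by (intro exI[of _ "(n', u + w n)"]) (simp add: P_def Q_def)
  qed
  then obtain f where f: "\<And>k. P k (f k)" "\<And>k. Q k (f k) (f (Suc k))" by blast
  define r where "r k = fst (f k)" for k
  have "strict_mono r"
    using f(2) by (simp add: strict_mono_Suc_iff r_def Q_def case_prod_beta)
  moreover have "snd (f k) = (\<Sum>i<k. w (r i))" for k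
  proof (induction k)
    case 0
    then show ?case using f(1)[of 0] by (simp add: P_def case_prod_beta)
  next
    case (Suc k)
    then show ?case using f(2)[of k] by (simp add: Q_def case_prod_beta r_def)
  qed
  then have "h (inf (\<Sum>i<k. w (r i)) (w (r k))) \<le> \<eta> k" for k
    using f(1)[of k] by (simp add: P_def case_prod_beta r_def)
  ultimately show thesis by (rule that)
qed

text \<open>
  Almost disjoint elements on which \<open>h \<bar>\<cdot>\<bar>\<close> is bounded below span a copy of \<open>\<ell>\<^sup>1\<close> in the seminorm
  \<open>h \<bar>\<cdot>\<bar>\<close>.
\<close>

lemma almost_disjoint_lower_bound:
  fixes z :: "nat \<Rightarrow> 'e::banach_lattice" and h :: "'e \<Rightarrow>\<^sub>L real"
  assumes h: "positive_functional h"
    and lower: "\<And>k. e \<le> h \<bar>z k\<bar>"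
    and disj: "\<And>k. h (inf (\<Sum>i<k. \<bar>z i\<bar>) \<bar>z k\<bar>) \<le> e * (1 / 2) ^ k / 8"
    and e: "0 \<le> e" and a: "\<And>k. 0 \<le> a k"
  shows "e / 2 * (\<Sum>k<m. a k) \<le> h \<bar>\<Sum>k<m. a k *\<^sub>R z k\<bar>"
proof -
  define A where "A = (\<Sum>k<m. a k)"
  have A: "0 \<le> A" "a k \<le> A" if "k < m" for k
    using that a by (auto simp: A_def intro: sum_nonneg member_le_sum)
  \<comment> \<open>Each step costs at most twice the overlap bound
    \<open>A * e * (1 / 2) ^ j / 8\<close>. The total is at most half of \<open>e * A\<close>, which
    explains the \<open>8\<close> in the hypothesis and the factor \<open>e / 2\<close> in the
    conclusion.\<close>
  have "e * (\<Sum>k<j. a k) - A * e / 4 * (\<Sum>k<j. (1 / 2) ^ k) \<le> h \<bar>\<Sum>k<j. a k *\<^sub>R z k\<bar>" if "j \<le> m" for j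
    using that
  proof (induction j)
    case 0
    then show ?case by (simp add: blinfun.zero_right)
  next
    case (Suc j)
    let ?S = "\<Sum>k<j. a k *\<^sub>R z k" and ?u = "\<Sum>k<j. \<bar>z k\<bar>"
    have "\<bar>?S\<bar> \<le> (\<Sum>k<j. \<bar>a k *\<^sub>R z k\<bar>)"
      by (rule sum_abs)
    \<comment> \<open>\<open>disj\<close> concerns unweighted sums, so all coefficients are raised
      to their common bound \<open>A\<close>.\<close>
    also have "\<dots> \<le> (\<Sum>k<j. A *\<^sub>R \<bar>z k\<bar>)"
      using Suc.prems a A(2) by (intro sum_mono) (auto simp: abs_scaleR_nonneg intro!: scaleR_right_mono)
    finally have "\<bar>?S\<bar> \<le> A *\<^sub>R ?u"
      by (simp add: scaleR_sum_right)
    moreover have "\<bar>a j *\<^sub>R z j\<bar> \<le> A *\<^sub>R \<bar>z j\<bar>"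
      using Suc.prems a A(2) by (auto simp: abs_scaleR_nonneg intro!: scaleR_right_mono)
    ultimately have "inf \<bar>?S\<bar> \<bar>a j *\<^sub>R z j\<bar> \<le> inf (A *\<^sub>R ?u) (A *\<^sub>R \<bar>z j\<bar>)"
      by (rule inf_mono)
    also have "\<dots> \<le> A *\<^sub>R inf ?u \<bar>z j\<bar>"
      using A(1)[of j] Suc.prems by (intro inf_scaleR_le) auto
    finally have "h (inf \<bar>?S\<bar> \<bar>a j *\<^sub>R z j\<bar>) \<le> A * h (inf ?u \<bar>z j\<bar>)"
      using positive_functional_mono[OF h] by (fastforce simp: blinfun.scaleR_right)
    also have "\<dots> \<le> A * (e * (1 / 2) ^ j / 8)"
      using A(1)[of j] Suc.prems by (intro mult_left_mono disj) auto
    finally have inf: "h (inf \<bar>?S\<bar> \<bar>a j *\<^sub>R z j\<bar>) \<le> A * e * (1 / 2) ^ j / 8" by simp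
    have "h (\<bar>?S\<bar> + \<bar>a j *\<^sub>R z j\<bar>) \<le> h (\<bar>?S + a j *\<^sub>R z j\<bar> + (inf \<bar>?S\<bar> \<bar>a j *\<^sub>R z j\<bar> + inf \<bar>?S\<bar> \<bar>a j *\<^sub>R z j\<bar>))"
      by (rule positive_functional_mono[OF h abs_add_abs_le])
    then have "h \<bar>?S\<bar> + a j * h \<bar>z j\<bar> \<le> h \<bar>?S + a j *\<^sub>R z j\<bar> + 2 * h (inf \<bar>?S\<bar> \<bar>a j *\<^sub>R z j\<bar>)"
      using a[of j] by (simp add: blinfun.add_right blinfun.scaleR_right abs_scaleR_nonneg)
    moreover have "a j * e \<le> a j * h \<bar>z j\<bar>"
      by (rule mult_left_mono[OF lower a])
    ultimately show ?case
      using Suc.IH Suc.prems inf by (simp add: algebra_simps)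
  qed
  from this[of m] have "e * A - A * e / 4 * (\<Sum>k<m. (1 / 2) ^ k) \<le> h \<bar>\<Sum>k<m. a k *\<^sub>R z k\<bar>"
    by (simp add: A_def)
  moreover have "(\<Sum>k<m. (1 / 2 :: real) ^ k) \<le> 2"
    by (simp add: sum_gp_strict)
  then have "A * e / 4 * (\<Sum>k<m. (1 / 2) ^ k) \<le> A * e / 4 * 2"
    using e a by (intro mult_left_mono) (auto simp: A_def intro!: sum_nonneg mult_nonneg_nonneg)
  ultimately show ?thesis by (simp add: A_def algebra_simps)
qed

text \<open>Hahn-Banach below the seminorm \<open>h \<bar>x\<bar>\<close> rather than the norm:
  \<open>lower\<close> is the domination condition on the cone generated by the pairs
  \<open>(z k, \<delta>)\<close>, and \<open>norm h\<close> still gives continuity.\<close>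

lemma functional_bounded_below_on_sequence:
  fixes z :: "nat \<Rightarrow> 'e::banach_lattice" and h :: "'e \<Rightarrow>\<^sub>L real"
  assumes h: "positive_functional h"
    and lower: "\<And>a m. (\<And>k. 0 \<le> a k) \<Longrightarrow> \<delta> * (\<Sum>k<m. a k) \<le> h \<bar>\<Sum>k<m. a k *\<^sub>R z k\<bar>"
  obtains g :: "'e \<Rightarrow>\<^sub>L real" where "\<And>k. \<delta> \<le> g (z k)"
proof -
  \<comment> \<open>Coefficients vanishing from \<open>m\<close> on let two combinations be padded
    to a common length before they are added.\<close>
  define D where "D = {(\<Sum>k<m. a k *\<^sub>R z k, \<delta> * (\<Sum>k<m. a k)) | a m. (\<forall>k. 0 \<le> a k) \<and> (\<forall>k\<ge>m. a k = 0)}"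
  have D_I: "(\<Sum>k<m. a k *\<^sub>R z k, \<delta> * (\<Sum>k<m. a k)) \<in> D"
    if "\<And>k. 0 \<le> a k" "\<And>k. m \<le> k \<Longrightarrow> a k = 0" for a m
    using that unfolding D_def by blast
  have extend: "(\<Sum>k<m. a k *\<^sub>R z k) = (\<Sum>k<M. a k *\<^sub>R z k)" "(\<Sum>k<m. a k) = (\<Sum>k<M. a k)"
    if "\<And>k. m \<le> k \<Longrightarrow> a k = 0" "m \<le> M" for a :: "nat \<Rightarrow> real" and m M
    using that by (auto intro!: sum.mono_neutral_left) (metis not_le)+
  interpret constrained_sublinear "\<lambda>x. h \<bar>x\<bar>" D
  proof
    show "sublinear (\<lambda>x. h \<bar>x\<bar>)"
      unfolding sublinear_def
    proof (intro conjI allI impI)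
      show "h \<bar>x + y\<bar> \<le> h \<bar>x\<bar> + h \<bar>y\<bar>" for x y
        using positive_functional_mono[OF h abs_triangle_ineq[of x y]] by (simp add: blinfun.add_right)
    qed (simp add: abs_scaleR_nonneg blinfun.scaleR_right)
    show "convex_cone D"
      unfolding convex_cone_iff
    proof (intro conjI ballI allI impI)
      show "0 \<in> D"
        using D_I[of "\<lambda>_. 0" 0] by (simp add: zero_prod_def)
    next
      fix v w assume "v \<in> D" "w \<in> D"
      then obtain a m b n where
        v: "v = (\<Sum>k<m. a k *\<^sub>R z k, \<delta> * (\<Sum>k<m. a k))" "\<And>k. 0 \<le> a k" "\<And>k. m \<le> k \<Longrightarrow> a k = 0" and
        w: "w = (\<Sum>k<n. b k *\<^sub>R z k, \<delta> * (\<Sum>k<n. b k))" "\<And>k. 0 \<le> b k" "\<And>k. n \<le> k \<Longrightarrow> b k = 0"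
        unfolding D_def by blast
      define M where "M = max m n"
      have "v = (\<Sum>k<M. a k *\<^sub>R z k, \<delta> * (\<Sum>k<M. a k))"
        using extend[of m a M] v by (simp add: M_def)
      moreover have "w = (\<Sum>k<M. b k *\<^sub>R z k, \<delta> * (\<Sum>k<M. b k))"
        using extend[of n b M] w by (simp add: M_def)
      moreover have "(\<Sum>k<M. (a k + b k) *\<^sub>R z k, \<delta> * (\<Sum>k<M. a k + b k)) \<in> D"
        using v w by (intro D_I) (auto simp: M_def)
      ultimately show "v + w \<in> D"
        by (simp add: scaleR_add_left sum.distrib distrib_left)
    next
      fix v and c :: real assume c: "0 \<le> c" and "v \<in> D"
      then obtain a m where
        v: "v = (\<Sum>k<m. a k *\<^sub>R z k, \<delta> * (\<Sum>k<m. a k))" "\<And>k. 0 \<le> a k" "\<And>k. m \<le> k \<Longrightarrow> a k = 0"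
        unfolding D_def by blast
      have "(\<Sum>k<m. (c * a k) *\<^sub>R z k, \<delta> * (\<Sum>k<m. c * a k)) \<in> D"
        using v c by (intro D_I) auto
      then show "c *\<^sub>R v \<in> D"
        by (simp add: v(1) scaleR_sum_right sum_distrib_left mult_ac)
    qed
  next
    fix x t assume "(x, t) \<in> D"
    then show "t \<le> h \<bar>x\<bar>"
      using lower by (auto simp: D_def)
  qed
  obtain g where g: "linear g" "\<And>x. g x \<le> h \<bar>x\<bar>" "\<And>x t. (x, t) \<in> D \<Longrightarrow> t \<le> g x"
    by (rule linear_between) blast
  have "g x \<le> norm h * norm x" for x
    using g(2)[of x] norm_blinfun[of h "\<bar>x\<bar>"] by (simp add: norm_abs_eq)
  then obtain g' where g': "blinfun_apply g' = g"
    by (rule linear_le_norm_imp_blinfun[OF g(1)])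
  have "\<delta> \<le> g (z k)" for k
  proof (rule g(3))
    have "(\<Sum>i<Suc k. of_bool (i = k) *\<^sub>R z i) = z k" "(\<Sum>i<Suc k. of_bool (i = k)) = (1 :: real)"
      by simp_all
    then show "(z k, \<delta>) \<in> D"
      using D_I[of "\<lambda>i. of_bool (i = k)" "Suc k"] by simp
  qed
  then show thesis by (intro that[of g']) (simp add: g')
qed

lemma not_tendsto_0_subseq:
  fixes a :: "nat \<Rightarrow> real"
  assumes "\<And>n. 0 \<le> a n" "\<not> a \<longlonglongrightarrow> 0"
  obtains e and q :: "nat \<Rightarrow> nat" where "0 < e" "strict_mono q" "\<And>n. e \<le> a (q n)"
proof -
  obtain e where e: "0 < e" "\<not> (\<forall>\<^sub>F n in sequentially. dist (a n) 0 < e)"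
    using assms(2) unfolding tendsto_iff by blast
  then have "infinite {n. e \<le> a n}"
    using assms(1) by (simp add: not_eventually frequently_cofinite not_less flip: cofinite_eq_sequentially)
  from infinite_enumerate[OF this] e(1) that show thesis by auto
qed

text \<open>
  Otherwise a subsequence is almost disjoint with \<open>h \<bar>\<cdot>\<bar>\<close> bounded below, and a functional separates
  it, with alternating signs, from \<open>0\<close>; its values along \<open>y\<close> cannot converge.
\<close>

lemma functional_abs_tendsto_0:
  fixes y :: "nat \<Rightarrow> 'e::banach_lattice"
  assumes y: "weakly_tendsto y l"
    and null: "\<And>u. 0 \<le> u \<Longrightarrow> weakly_tendsto (\<lambda>n. inf \<bar>y n\<bar> u) 0"
    and h: "positive_functional h"
  shows "(\<lambda>n. h \<bar>y n\<bar>) \<longlonglongrightarrow> 0"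
proof (rule ccontr)
  assume "\<not> ?thesis"
  then obtain e and q :: "nat \<Rightarrow> nat"
    where e: "0 < e" and q: "strict_mono q" "\<And>n. e \<le> h \<bar>y (q n)\<bar>"
    by (rule not_tendsto_0_subseq[rotated]) (auto intro: positive_functional_nonneg[OF h])
  obtain r where r: "strict_mono r"
    "\<And>k. h (inf (\<Sum>i<k. \<bar>y (q (r i))\<bar>) \<bar>y (q (r k))\<bar>) \<le> e * (1 / 2) ^ k / 8"
  proof (rule almost_disjoint_subseq[of "\<lambda>n. \<bar>y (q n)\<bar>" h "\<lambda>k. e * (1 / 2) ^ k / 8"])
    fix u :: 'e assume "0 \<le> u"
    then have "(\<lambda>n. h (inf \<bar>y n\<bar> u)) \<longlonglongrightarrow> 0"
      using null[of u] by (simp add: weakly_tendsto_iff blinfun.zero_right)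
    from LIMSEQ_subseq_LIMSEQ[OF this q(1)] show "(\<lambda>n. h (inf \<bar>y (q n)\<bar> u)) \<longlonglongrightarrow> 0"
      by (simp add: o_def)
  qed (use e in auto)
  define x where "x k = y (q (r k))" for k
  \<comment> \<open>Signs leave the moduli, and with them both estimates, unchanged; but a
    functional that is at least \<open>e / 2\<close> on all \<open>z k\<close> must alternate along
    \<open>x\<close>.\<close>
  define z where "z k = (- 1) ^ k *\<^sub>R x k" for k
  have abs_z: "\<bar>z k\<bar> = \<bar>x k\<bar>" for k
    by (cases "even k") (simp_all add: z_def)
  have lower: "e / 2 * (\<Sum>k<m. a k) \<le> h \<bar>\<Sum>k<m. a k *\<^sub>R z k\<bar>" if "\<And>k. 0 \<le> a k" for a m
    using that e q(2) r(2) by (intro almost_disjoint_lower_bound[OF h]) (auto simp: abs_z x_def)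
  obtain g :: "'e \<Rightarrow>\<^sub>L real" where g: "\<And>k. e / 2 \<le> g (z k)"
    using functional_bounded_below_on_sequence[OF h lower] by blast
  have "strict_mono (q \<circ> r)"
    using q(1) r(1) by (rule strict_mono_o)
  moreover have "(\<lambda>n. g (y n)) \<longlonglongrightarrow> g l"
    using y by (simp add: weakly_tendsto_iff)
  ultimately have x: "(\<lambda>k. g (x k)) \<longlonglongrightarrow> g l"
    using LIMSEQ_subseq_LIMSEQ[of "\<lambda>n. g (y n)" "g l" "q \<circ> r"] by (simp add: o_def x_def)
  \<comment> \<open>Even indices force \<open>g l\<close> to be at least \<open>e / 2\<close>, odd
    indices to be at most \<open>- (e / 2)\<close>.\<close>
  have "(\<lambda>k. g (x (2 * k))) \<longlonglongrightarrow> g l"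
    using LIMSEQ_subseq_LIMSEQ[OF x, of "\<lambda>k. 2 * k"] by (simp add: strict_mono_def o_def)
  moreover have "e / 2 \<le> g (x (2 * k))" for k
    using g[of "2 * k"] by (simp add: z_def)
  ultimately have "e / 2 \<le> g l"
    by (intro LIMSEQ_le_const) auto
  have "(\<lambda>k. g (x (2 * k + 1))) \<longlonglongrightarrow> g l"
    using LIMSEQ_subseq_LIMSEQ[OF x, of "\<lambda>k. 2 * k + 1"] by (simp add: strict_mono_def o_def)
  moreover have "g (x (2 * k + 1)) \<le> - (e / 2)" for k
    using g[of "2 * k + 1"] by (simp add: z_def blinfun.minus_right)
  ultimately have "g l \<le> - (e / 2)"
    by (intro LIMSEQ_le_const2) auto
  with \<open>e / 2 \<le> g l\<close> e show False by simp
qed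

lemma weakly_tendsto_diff_const:
  "weakly_tendsto y l \<Longrightarrow> weakly_tendsto (\<lambda>n. y n - c) (l - c)"
  unfolding weakly_tendsto_iff by (auto simp: blinfun.diff_right intro: tendsto_diff)

lemma weakly_tendsto_unique:
  assumes "weakly_tendsto y l" "weakly_tendsto y l'"
  shows "l = l'"
proof (rule ccontr)
  assume "l \<noteq> l'"
  then obtain f :: "'a \<Rightarrow>\<^sub>L real" where "f l \<noteq> f l'" by (rule separating_functional) blast
  then show False
    using assms LIMSEQ_unique unfolding weakly_tendsto_iff by blast
qed

text \<open>\<open>functional_abs_tendsto_0\<close> for \<open>y n - l'\<close>, whose weak limit is
  \<open>l - l'\<close>, gives weak convergence of \<open>y\<close> to \<open>l'\<close>; uniqueness
  of weak limits identifies the two limits.\<close>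

lemma weak_and_uaw_limit:
  fixes y :: "nat \<Rightarrow> 'e::banach_lattice"
  assumes y: "weakly_tendsto y l" and uaw: "uaw_tendsto y l'"
  shows "l' = l" "weakly_tendsto (\<lambda>n. \<bar>y n - l\<bar>) 0"
proof -
  have null: "(\<lambda>n. h \<bar>y n - l'\<bar>) \<longlonglongrightarrow> 0" if "positive_functional h" for h
    using functional_abs_tendsto_0[OF weakly_tendsto_diff_const[OF y] _ that] uaw
    by (auto simp: uaw_tendsto_def)
  then have "weakly_tendsto (\<lambda>n. y n - l') 0"
    by (rule weakly_tendsto_0_if_positive)
  then have "l - l' = 0"
    using weakly_tendsto_unique[OF weakly_tendsto_diff_const[OF y]] by blast
  then show "l' = l" by simp
  with null show "weakly_tendsto (\<lambda>n. \<bar>y n - l\<bar>) 0"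
    by (intro weakly_tendsto_0_if_positive) simp
qed

section \<open>Operators on the space of summable sequences\<close>

lemma ell1_simps [simp]:
  "carr ell1 = {a. summable (\<lambda>n. \<bar>a n\<bar>)}" "add ell1 a b = (\<lambda>n. a n + b n)" "zero ell1 = (\<lambda>n. 0)"
  "scl ell1 c a = (\<lambda>n. c * a n)" "nrm ell1 a = (\<Sum>n. \<bar>a n\<bar>)"
  by (simp_all add: ell1_def)

lemma ell1_diff: "diff ell1 a b = (\<lambda>n. a n - b n)"
  by (simp add: diff_def)

lemma summable_abs_add:
  fixes a b :: "nat \<Rightarrow> real"
  assumes "summable (\<lambda>n. \<bar>a n\<bar>)" "summable (\<lambda>n. \<bar>b n\<bar>)"
  shows "summable (\<lambda>n. \<bar>a n + b n\<bar>)"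
  using summable_add[OF assms] by (rule summable_comparison_test[rotated]) (auto intro!: exI[of _ 0] abs_triangle_ineq)

lemma summable_abs_diff:
  fixes a b :: "nat \<Rightarrow> real"
  assumes "summable (\<lambda>n. \<bar>a n\<bar>)" "summable (\<lambda>n. \<bar>b n\<bar>)"
  shows "summable (\<lambda>n. \<bar>a n - b n\<bar>)"
  using summable_abs_add[OF assms(1), of "\<lambda>n. - b n"] assms(2) by simp

lemma ell1_complete:
  fixes s :: "nat \<Rightarrow> nat \<Rightarrow> real"
  assumes s: "\<And>i. summable (\<lambda>n. \<bar>s i n\<bar>)"
    and Cauchy: "\<And>e. 0 < e \<Longrightarrow> \<exists>N. \<forall>i\<ge>N. \<forall>j\<ge>N. (\<Sum>n. \<bar>s i n - s j n\<bar>) < e"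
  obtains a where "summable (\<lambda>n. \<bar>a n\<bar>)" "(\<lambda>i. \<Sum>n. \<bar>s i n - a n\<bar>) \<longlonglongrightarrow> 0"
proof -
  have partial: "(\<Sum>n<m. \<bar>s i n - s j n\<bar>) \<le> (\<Sum>n. \<bar>s i n - s j n\<bar>)" for i j m
    by (rule sum_le_suminf[OF summable_abs_diff[OF s s]]) auto
  have "Cauchy (\<lambda>i. s i n)" for n
  proof (rule metric_CauchyI)
    fix e :: real assume "0 < e"
    then obtain N where N: "\<And>i j. N \<le> i \<Longrightarrow> N \<le> j \<Longrightarrow> (\<Sum>n. \<bar>s i n - s j n\<bar>) < e"
      using Cauchy by blast
    have le: "dist (s i n) (s j n) \<le> (\<Sum>n. \<bar>s i n - s j n\<bar>)" for i j
      using sum_le_suminf[OF summable_abs_diff[OF s s], of "{n}" i j] by (simp add: dist_real_def)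
    show "\<exists>N. \<forall>i\<ge>N. \<forall>j\<ge>N. dist (s i n) (s j n) < e"
      using le_less_trans[OF le N] by blast
  qed
  then have "\<forall>n. \<exists>l. (\<lambda>i. s i n) \<longlonglongrightarrow> l"
    by (simp add: Cauchy_convergent_iff convergent_def)
  from choice[OF this] obtain a where a: "\<And>n. (\<lambda>i. s i n) \<longlonglongrightarrow> a n" by blast
  \<comment> \<open>Bounds on finite sums survive the pointwise limit in \<open>j\<close>, and being
    uniform in \<open>m\<close> they pass to the series.\<close>
  have tail: "\<exists>N. \<forall>i\<ge>N. \<forall>m. (\<Sum>n<m. \<bar>s i n - a n\<bar>) \<le> e" if e: "0 < e" for e
  proof -
    obtain N where N: "\<And>i j. N \<le> i \<Longrightarrow> N \<le> j \<Longrightarrow> (\<Sum>n. \<bar>s i n - s j n\<bar>) < e"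
      using Cauchy[OF e] by blast
    have "(\<Sum>n<m. \<bar>s i n - a n\<bar>) \<le> e" if "N \<le> i" for i m
    proof (rule LIMSEQ_le_const2)
      show "(\<lambda>j. \<Sum>n<m. \<bar>s i n - s j n\<bar>) \<longlonglongrightarrow> (\<Sum>n<m. \<bar>s i n - a n\<bar>)"
        by (intro tendsto_intros a)
      show "\<exists>M. \<forall>j\<ge>M. (\<Sum>n<m. \<bar>s i n - s j n\<bar>) \<le> e"
        using order_trans[OF partial less_imp_le[OF N[OF that]]] by blast
    qed
    then show ?thesis by blast
  qed
  have summable_diff: "\<exists>N. \<forall>i\<ge>N. summable (\<lambda>n. \<bar>s i n - a n\<bar>)"
  proof -
    obtain N where N: "\<And>i m. N \<le> i \<Longrightarrow> (\<Sum>n<m. \<bar>s i n - a n\<bar>) \<le> 1"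
      using tail[of 1] by auto
    have "summable (\<lambda>n. \<bar>s i n - a n\<bar>)" if "N \<le> i" for i
      by (rule summableI_nonneg_bounded[of _ 1]) (use N[OF that] in auto)
    then show ?thesis by blast
  qed
  then obtain N0 where N0: "\<And>i. N0 \<le> i \<Longrightarrow> summable (\<lambda>n. \<bar>s i n - a n\<bar>)" by blast
  show thesis
  proof (rule that[of a])
    \<comment> \<open>\<open>a\<close> is \<open>s N0\<close> minus \<open>s N0 - a\<close>, a
      difference of summable sequences.\<close>
    show "summable (\<lambda>n. \<bar>a n\<bar>)"
      using summable_abs_diff[OF s[of N0] N0[OF order_refl]] by simp
    show "(\<lambda>i. \<Sum>n. \<bar>s i n - a n\<bar>) \<longlonglongrightarrow> 0"
    proof (rule LIMSEQ_I)
      fix e :: real assume "0 < e"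
      then obtain N where N: "\<And>i m. N \<le> i \<Longrightarrow> (\<Sum>n<m. \<bar>s i n - a n\<bar>) \<le> e / 2"
        using tail[of "e / 2"] by auto
      have "norm ((\<Sum>n. \<bar>s i n - a n\<bar>) - 0) < e" if "max N N0 \<le> i" for i
      proof -
        have "(\<Sum>n. \<bar>s i n - a n\<bar>) \<le> e / 2"
          using that by (intro suminf_le_const N0 N) auto
        moreover have "0 \<le> (\<Sum>n. \<bar>s i n - a n\<bar>)"
          using that by (intro suminf_nonneg N0) auto
        ultimately show ?thesis using \<open>0 < e\<close> by simp
      qed
      then show "\<exists>no. \<forall>i\<ge>no. norm ((\<Sum>n. \<bar>s i n - a n\<bar>) - 0) < e" by blast
    qed
  qed
qed

lemma banach_space_ell1: "banach_space ell1"
proof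
  fix a b :: "nat \<Rightarrow> real" assume "a \<in> carr ell1" "b \<in> carr ell1"
  then have ab: "summable (\<lambda>n. \<bar>a n\<bar>)" "summable (\<lambda>n. \<bar>b n\<bar>)" by simp_all
  then show "add ell1 a b \<in> carr ell1"
    by (simp add: summable_abs_add)
  have "(\<Sum>n. \<bar>a n + b n\<bar>) \<le> (\<Sum>n. \<bar>a n\<bar> + \<bar>b n\<bar>)"
    using ab by (intro suminf_le summable_abs_add summable_add) auto
  then show "nrm ell1 (add ell1 a b) \<le> nrm ell1 a + nrm ell1 b"
    using ab by (simp add: suminf_add)
next
  fix a :: "nat \<Rightarrow> real" and c :: real assume "a \<in> carr ell1"
  then have a: "summable (\<lambda>n. \<bar>a n\<bar>)" by simp
  then show "scl ell1 c a \<in> carr ell1"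
    by (simp add: abs_mult summable_mult)
  show "0 \<le> nrm ell1 a"
    using a by (simp add: suminf_nonneg)
  show "nrm ell1 a = 0 \<longleftrightarrow> a = zero ell1"
    using a by (auto simp: suminf_eq_zero_iff)
  show "nrm ell1 (scl ell1 c a) = \<bar>c\<bar> * nrm ell1 a"
    using a by (simp add: abs_mult suminf_mult)
next
  fix s :: "nat \<Rightarrow> nat \<Rightarrow> real"
  assume "\<And>n. s n \<in> carr ell1"
    and "\<And>e. e > 0 \<Longrightarrow> \<exists>N. \<forall>m\<ge>N. \<forall>n\<ge>N. nrm ell1 (diff ell1 (s m) (s n)) < e"
  then obtain a where "summable (\<lambda>n. \<bar>a n\<bar>)" "(\<lambda>i. \<Sum>n. \<bar>s i n - a n\<bar>) \<longlonglongrightarrow> 0"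
    by (rule_tac ell1_complete[of s]) (simp_all add: ell1_diff)
  then show "\<exists>x\<in>carr ell1. (\<lambda>n. nrm ell1 (diff ell1 (s n) x)) \<longlonglongrightarrow> 0"
    by (auto simp: ell1_diff)
qed (auto simp: ell1_diff algebra_simps)

section \<open>Copies of spaces and operators along injections\<close>

definition nspace_copy :: "('x \<Rightarrow> 'y) \<Rightarrow> 'x nspace \<Rightarrow> 'y nspace" where
  "nspace_copy i X = \<lparr>carr = i ` carr X, add = (\<lambda>x y. i (add X (inv i x) (inv i y))),
     zero = i (zero X), scl = (\<lambda>c x. i (scl X c (inv i x))), nrm = (\<lambda>x. nrm X (inv i x))\<rparr>"

lemma nspace_copy_simps [simp]:
  "carr (nspace_copy i X) = i ` carr X"
  "add (nspace_copy i X) x y = i (add X (inv i x) (inv i y))"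
  "zero (nspace_copy i X) = i (zero X)"
  "scl (nspace_copy i X) c x = i (scl X c (inv i x))"
  "nrm (nspace_copy i X) x = nrm X (inv i x)"
  by (simp_all add: nspace_copy_def)

lemma diff_nspace_copy: "inj i \<Longrightarrow> diff (nspace_copy i X) (i x) (i y) = i (diff X x y)"
  by (simp add: diff_def)

lemma banach_space_copy:
  assumes X: "banach_space X" and i: "inj i"
  shows "banach_space (nspace_copy i X)"
proof -
  interpret banach_space X by (rule X)
  show ?thesis
  proof (unfold_locales, goal_cases)
    case (16 s)
    define t where "t n = inv i (s n)" for n
    have st: "s n = i (t n)" "t n \<in> carr X" for n
      using 16(1)[of n] i by (auto simp: t_def)
    have "\<exists>x\<in>carr X. (\<lambda>n. nrm X (diff X (t n) x)) \<longlonglongrightarrow> 0"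
      using 16(2) i by (intro complete st) (simp add: st(1) diff_nspace_copy)
    then show ?case
      using i by (auto simp: st(1) diff_nspace_copy)
  qed (use i in \<open>auto simp: diff_nspace_copy zero_closed add_closed scl_closed add_assoc add_zero
        diff_self scl_add_right scl_add_left scl_scl scl_one nrm_nonneg nrm_eq_0 nrm_triangle nrm_scl
        inj_eq intro: add_commute\<close>)
qed

lemma bounded_operator_copy:
  "inj i \<Longrightarrow> bounded_operator (nspace_copy i X) (T \<circ> inv i) \<longleftrightarrow> bounded_operator X T"
  by (simp add: bounded_operator_def)

lemma weakly_compact_operator_copy:
  assumes "inj i"
  shows "weakly_compact_operator (nspace_copy i X) (T \<circ> inv i) \<longleftrightarrow> weakly_compact_operator X T"
proof -
  have "(T \<circ> inv i) ` {x \<in> carr (nspace_copy i X). nrm (nspace_copy i X) x \<le> 1}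
      = T ` {x \<in> carr X. nrm X x \<le> 1}"
    using assms by (force simp: image_iff)
  then show ?thesis
    unfolding weakly_compact_operator_def by (simp only: bounded_operator_copy[OF assms])
qed

lemma seq_uaw_compact_operatorD:
  assumes "seq_uaw_compact_operator X T" "\<And>n. s n \<in> carr X" "\<And>n. nrm X (s n) \<le> M"
  obtains r l where "strict_mono (r :: nat \<Rightarrow> nat)" "uaw_tendsto (\<lambda>n. T (s (r n))) l"
proof -
  have "(\<forall>n. s n \<in> carr X) \<and> (\<exists>M. \<forall>n. nrm X (s n) \<le> M)"
    using assms(2,3) by blast
  then have "\<exists>r l. strict_mono (r :: nat \<Rightarrow> nat) \<and> uaw_tendsto (\<lambda>n. T (s (r n))) l"
    by (rule assms(1)[unfolded seq_uaw_compact_operator_def, THEN conjunct2, THEN spec, THEN mp])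
  with that show thesis by blast
qed

lemma seq_uaw_compact_operator_copy:
  assumes i: "inj i" and T: "seq_uaw_compact_operator (nspace_copy i X) (T \<circ> inv i)"
  shows "seq_uaw_compact_operator X T"
  unfolding seq_uaw_compact_operator_def
proof (intro conjI allI impI)
  show "bounded_operator X T"
    using T by (simp add: seq_uaw_compact_operator_def bounded_operator_copy[OF i])
  fix s :: "nat \<Rightarrow> 'a" assume s: "(\<forall>n. s n \<in> carr X) \<and> (\<exists>M. \<forall>n. nrm X (s n) \<le> M)"
  then obtain M where M: "\<And>n. nrm X (s n) \<le> M" by blast
  have "i (s n) \<in> carr (nspace_copy i X)" "nrm (nspace_copy i X) (i (s n)) \<le> M" for n
    using s i M by simp_all
  from seq_uaw_compact_operatorD[OF T this] obtain r l
    where "strict_mono (r :: nat \<Rightarrow> nat)" "uaw_tendsto (\<lambda>n. (T \<circ> inv i) (i (s (r n)))) l" .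
  then show "\<exists>r l. strict_mono (r :: nat \<Rightarrow> nat) \<and> uaw_tendsto (\<lambda>n. T (s (r n))) l"
    using i by (intro exI[of _ r] exI[of _ l]) simp
qed

section \<open>Weak compactness of operators given by weakly null sequences\<close>

lemma compact_ell1_ball:
  "compactin euclidean {a :: nat \<Rightarrow> real. summable (\<lambda>n. \<bar>a n\<bar>) \<and> (\<Sum>n. \<bar>a n\<bar>) \<le> 1}"
proof -
  \<comment> \<open>Each bound on a partial sum involves finitely many coordinates and is closed
    under pointwise convergence, whereas the norm is only lower semicontinuous. The ball is thus a
    closed subset of a compact cube, as in Banach-Alaoglu.\<close>
  have eq: "{a :: nat \<Rightarrow> real. summable (\<lambda>n. \<bar>a n\<bar>) \<and> (\<Sum>n. \<bar>a n\<bar>) \<le> 1} =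
      Pi\<^sub>E UNIV (\<lambda>_. {-1..1}) \<inter> {a. \<forall>m. (\<Sum>n<m. \<bar>a n\<bar>) \<le> 1}" (is "?B = ?K \<inter> ?C")
  proof (intro set_eqI iffI)
    fix a assume "a \<in> ?B"
    then have a: "summable (\<lambda>n. \<bar>a n\<bar>)" "(\<Sum>n. \<bar>a n\<bar>) \<le> 1" by auto
    have "(\<Sum>n\<in>I. \<bar>a n\<bar>) \<le> 1" if "finite I" for I
      using sum_le_suminf[OF a(1) that] a(2) by simp
    from this[of "{..<m}" for m] this[of "{n}" for n] show "a \<in> ?K \<inter> ?C"
      by (auto simp: abs_le_iff minus_le_iff)
  next
    fix a assume "a \<in> ?K \<inter> ?C"
    then have bound: "(\<Sum>n<m. \<bar>a n\<bar>) \<le> 1" for m by simp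
    moreover from bound have "summable (\<lambda>n. \<bar>a n\<bar>)"
      by (intro summableI_nonneg_bounded[of _ 1]) auto
    ultimately show "a \<in> ?B"
      by (auto intro: suminf_le_const)
  qed
  have "compactin (product_topology (\<lambda>_. euclideanreal) UNIV) ?K"
    by (simp add: compactin_PiE)
  then have "compact ?K"
    by (simp add: euclidean_product_topology)
  moreover have "closed ?C"
  proof (intro closed_Collect_all closed_Collect_le)
    have "continuous_on UNIV (\<lambda>a :: nat \<Rightarrow> real. a n)" for n
      by (rule continuous_on_product_coordinates)
    then show "continuous_on UNIV (\<lambda>a :: nat \<Rightarrow> real. \<Sum>n<m. \<bar>a n\<bar>)" for m
      by (intro continuous_on_sum continuous_on_rabs)
  qed simp
  ultimately show ?thesis
    unfolding eq by (simp add: compact_Int_closed)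
qed

text \<open>The tail of \<open>a\<close> has norm at most \<open>1\<close>, so the truncation error
  is controlled by \<open>c\<close> alone; this makes convergence uniform over the unit
  ball.\<close>

lemma tail_sum_bound:
  fixes a c :: "nat \<Rightarrow> real"
  assumes a: "summable (\<lambda>n. \<bar>a n\<bar>)" "(\<Sum>n. \<bar>a n\<bar>) \<le> 1"
    and c: "\<And>n. N \<le> n \<Longrightarrow> \<bar>c n\<bar> \<le> e" and summable: "summable (\<lambda>n. a n * c n)"
    and m: "N \<le> m" and e: "0 \<le> e"
  shows "\<bar>(\<Sum>n. a n * c n) - (\<Sum>n<m. a n * c n)\<bar> \<le> e"
proof -
  have le: "\<bar>a (n + m) * c (n + m)\<bar> \<le> \<bar>a (n + m)\<bar> * e" for n
    using c[of "n + m"] m by (simp add: abs_mult mult_left_mono)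
  have a': "summable (\<lambda>n. \<bar>a (n + m)\<bar>)"
    using summable_iff_shift[of "\<lambda>n. \<bar>a n\<bar>" m] a(1) by simp
  then have s: "summable (\<lambda>n. \<bar>a (n + m)\<bar> * e)"
    by (rule summable_mult2)
  have "(\<Sum>n. a n * c n) - (\<Sum>n<m. a n * c n) = (\<Sum>n. a (n + m) * c (n + m))"
    using suminf_split_initial_segment[OF summable, of m] by simp
  also have "\<bar>\<dots>\<bar> \<le> (\<Sum>n. \<bar>a (n + m)\<bar> * e)"
    using norm_suminf_le[of "\<lambda>n. a (n + m) * c (n + m)", OF _ s] le by simp
  also have "\<dots> = (\<Sum>n. \<bar>a (n + m)\<bar>) * e"
    using suminf_mult2[OF a'] by simp
  also have "\<dots> \<le> (\<Sum>n. \<bar>a n\<bar>) * e"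
    using suminf_split_initial_segment[OF a(1), of m] e
    by (intro mult_right_mono) (auto intro: sum_nonneg)
  also have "\<dots> \<le> 1 * e"
    using a(2) e by (intro mult_right_mono)
  finally show ?thesis by simp
qed

locale weakly_null_sequence =
  fixes x :: "nat \<Rightarrow> 'a::banach"
  assumes null: "weakly_tendsto x 0"
begin

definition series_operator :: "(nat \<Rightarrow> real) \<Rightarrow> 'a" where
  "series_operator a = (\<Sum>n. a n *\<^sub>R x n)"

lemma summable_series_operator:
  assumes "summable (\<lambda>n. \<bar>a n\<bar>)"
  shows "summable (\<lambda>n. norm (a n *\<^sub>R x n))"
proof -
  obtain B where "\<And>n. norm (x n) \<le> B"
    using weakly_tendsto_imp_bounded[OF null] by (auto simp: bounded_iff)
  then have "norm (norm (a n *\<^sub>R x n)) \<le> \<bar>a n\<bar> * B" for n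
    by (simp add: mult_left_mono)
  then show ?thesis
    by (intro summable_comparison_test[OF _ summable_mult2[OF assms, of B]]) blast
qed

lemma series_operator_sums:
  "summable (\<lambda>n. \<bar>a n\<bar>) \<Longrightarrow> (\<lambda>n. a n *\<^sub>R x n) sums series_operator a"
  unfolding series_operator_def
  by (rule summable_sums[OF summable_norm_cancel[OF summable_series_operator]])

lemma bounded_operator_series_operator: "bounded_operator ell1 series_operator"
proof -
  obtain B where B: "\<And>n. norm (x n) \<le> B"
    using weakly_tendsto_imp_bounded[OF null] by (auto simp: bounded_iff)
  have "norm (series_operator a) \<le> B * (\<Sum>n. \<bar>a n\<bar>)" if a: "summable (\<lambda>n. \<bar>a n\<bar>)" for a
  proof -
    have "norm (series_operator a) \<le> (\<Sum>n. norm (a n *\<^sub>R x n))"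
      unfolding series_operator_def by (rule summable_norm[OF summable_series_operator[OF a]])
    also have "\<dots> \<le> (\<Sum>n. B * \<bar>a n\<bar>)"
      using B by (intro suminf_le summable_mult a summable_series_operator) (simp add: mult.commute[of B] mult_left_mono)
    finally show ?thesis using a by (simp add: suminf_mult)
  qed
  moreover have "series_operator (\<lambda>n. a n + b n) = series_operator a + series_operator b"
    if "summable (\<lambda>n. \<bar>a n\<bar>)" "summable (\<lambda>n. \<bar>b n\<bar>)" for a b
    using sums_add[OF series_operator_sums[OF that(1)] series_operator_sums[OF that(2)]]
    by (simp add: series_operator_def scaleR_add_left sums_iff)
  moreover have "series_operator (\<lambda>n. c * a n) = c *\<^sub>R series_operator a"
    if "summable (\<lambda>n. \<bar>a n\<bar>)" for a c
    using sums_scaleR_right[OF series_operator_sums[OF that], of c]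
    by (simp add: series_operator_def sums_iff)
  ultimately show ?thesis
    unfolding bounded_operator_def by auto
qed

lemma series_operator_unit: "series_operator (\<lambda>n. of_bool (n = k)) = x k"
proof -
  have "(\<lambda>n. of_bool (n = k) *\<^sub>R x n) sums (\<Sum>n\<in>{k}. of_bool (n = k) *\<^sub>R x n)"
    by (rule sums_finite) auto
  then show ?thesis by (simp add: series_operator_def sums_iff)
qed

text \<open>
  Since \<open>f (x n)\<close> tends to \<open>0\<close>, the operator is continuous from the weak* topology of \<open>\<ell>\<^sup>1\<close> as the
  dual of \<open>c\<^sub>0\<close>, which on the unit ball is the topology of pointwise convergence, to the weak topology.
\<close>

lemma weakly_compact_series_operator: "weakly_compact_operator ell1 series_operator"
  unfolding weakly_compact_operator_def
proof (intro conjI bounded_operator_series_operator)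
  let ?B = "{a :: nat \<Rightarrow> real. summable (\<lambda>n. \<bar>a n\<bar>) \<and> (\<Sum>n. \<bar>a n\<bar>) \<le> 1}"
  have "continuous_on ?B (\<lambda>a. f (series_operator a))" for f :: "'a \<Rightarrow>\<^sub>L real"
  \<comment> \<open>The truncated series depend on finitely many coordinates, hence are continuous;
    the tail estimate makes them converge uniformly on \<open>?B\<close>.\<close>
  proof (rule uniform_limit_theorem)
    have "continuous_on ?B (\<lambda>a. a n)" for n
      by (rule continuous_on_subset[OF continuous_on_product_coordinates]) simp
    then show "\<forall>\<^sub>F m in sequentially. continuous_on ?B (\<lambda>a. \<Sum>n<m. a n * f (x n))"
      by (intro always_eventually allI continuous_on_sum continuous_on_mult_right)
    show "uniform_limit ?B (\<lambda>m a. \<Sum>n<m. a n * f (x n)) (\<lambda>a. f (series_operator a)) sequentially"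
    proof (rule uniform_limitI)
      fix e :: real assume e: "0 < e"
      have "(\<lambda>n. f (x n)) \<longlonglongrightarrow> 0"
        using null by (simp add: weakly_tendsto_iff blinfun.zero_right)
      then obtain N where N: "\<And>n. N \<le> n \<Longrightarrow> \<bar>f (x n)\<bar> \<le> e / 2"
        using LIMSEQ_D[of "\<lambda>n. f (x n)" 0 "e / 2"] e by (auto intro: less_imp_le)
      have "dist (\<Sum>n<m. a n * f (x n)) (f (series_operator a)) < e" if "N \<le> m" "a \<in> ?B" for m a
      proof -
        have a: "summable (\<lambda>n. \<bar>a n\<bar>)" "(\<Sum>n. \<bar>a n\<bar>) \<le> 1" using that by auto
        have "(\<lambda>n. f (a n *\<^sub>R x n)) sums f (series_operator a)"
          using series_operator_sums[OF a(1)] by (rule bounded_linear.sums[OF blinfun.bounded_linear_right])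
        then have "(\<lambda>n. a n * f (x n)) sums f (series_operator a)"
          by (simp add: blinfun.scaleR_right)
        then have "summable (\<lambda>n. a n * f (x n))" "f (series_operator a) = (\<Sum>n. a n * f (x n))"
          by (simp_all add: sums_iff)
        with tail_sum_bound[of a N "\<lambda>n. f (x n)" "e / 2" m, OF a N _ that(1)] e show ?thesis
          by (simp add: dist_real_def abs_minus_commute)
      qed
      then show "\<forall>\<^sub>F m in sequentially. \<forall>a\<in>?B. dist (\<Sum>n<m. a n * f (x n)) (f (series_operator a)) < e"
        unfolding eventually_sequentially by blast
    qed
  qed simp
  then have "continuous_map (subtopology euclidean ?B) weak_topology series_operator"
    by (simp add: continuous_map_weak_topology)
  moreover have "compactin (subtopology euclidean ?B) ?B"
    using compact_ell1_ball by (simp add: compactin_subtopology)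
  ultimately have compact: "compactin weak_topology (series_operator ` ?B)"
    by (rule image_compactin[rotated])
  \<comment> \<open>A compact set in a Hausdorff topology is closed, so the image of the ball is its
    own weak closure.\<close>
  moreover have "closedin weak_topology (series_operator ` ?B)"
    by (rule compactin_imp_closedin[OF Hausdorff_weak_topology compact])
  ultimately show "compactin weak_topology
      (weak_topology closure_of series_operator ` {a \<in> carr ell1. nrm ell1 a \<le> 1})"
    by (simp add: closure_of_closedin)
qed

end

section \<open>The equivalences\<close>

lemma weakly_tendsto_scaleR:
  "weakly_tendsto y l \<Longrightarrow> weakly_tendsto (\<lambda>n. c *\<^sub>R y n) (c *\<^sub>R l)"
  unfolding weakly_tendsto_iff by (simp add: blinfun.scaleR_right tendsto_mult_left)

lemma weakly_compact_operator_subseq: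
  assumes X: "banach_space X" and T: "weakly_compact_operator X T"
    and s: "\<And>n. s n \<in> carr X" "\<And>n. nrm X (s n) \<le> M"
  obtains r l where "strict_mono (r :: nat \<Rightarrow> nat)" "weakly_tendsto (\<lambda>n. T (s (r n))) l"
proof -
  interpret banach_space X by (rule X)
  \<comment> \<open>The maximum with \<open>1\<close> keeps the scale positive whatever
    \<open>M\<close> is; dividing by it moves the sequence into the unit ball.\<close>
  define c where "c = max M 1"
  have c: "0 < c" "M \<le> c" by (simp_all add: c_def)
  define y where "y n = T (scl X (inverse c) (s n))" for n
  let ?B = "{x \<in> carr X. nrm X x \<le> 1}"
  have "nrm X (s n) \<le> c" for n
    using s(2) c(2) by (rule order_trans)
  then have ball: "scl X (inverse c) (s n) \<in> ?B" for n
    using c(1) s(1) by (simp add: scl_closed nrm_scl field_simps)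
  have bounded_op: "bounded_operator X T"
    and compact: "compactin weak_topology (weak_topology closure_of (T ` ?B))"
    using T by (simp_all add: weakly_compact_operator_def)
  obtain K where K: "\<And>x. x \<in> carr X \<Longrightarrow> norm (T x) \<le> K * nrm X x"
    using bounded_op unfolding bounded_operator_def by blast
  have "norm (y n) \<le> \<bar>K\<bar>" for n
  proof -
    let ?x = "scl X (inverse c) (s n)"
    have x: "?x \<in> carr X" "nrm X ?x \<le> 1" using ball[of n] by simp_all
    have "norm (y n) \<le> K * nrm X ?x"
      unfolding y_def by (rule K[OF x(1)])
    also have "\<dots> \<le> \<bar>K\<bar> * 1"
      using x nrm_nonneg[OF x(1)] by (intro mult_mono) auto
    finally show ?thesis by simp
  qed
  moreover have "y n \<in> weak_topology closure_of (T ` ?B)" for n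
  proof -
    have "y n \<in> T ` ?B"
      unfolding y_def using ball by (rule imageI)
    then show ?thesis
      using closure_of_subset[of "T ` ?B" weak_topology] by auto
  qed
  ultimately obtain r l where r: "strict_mono r" "weakly_tendsto (\<lambda>n. y (r n)) l"
    using weakly_compact_imp_weakly_convergent_subseq[OF compact, of y] by metis
  have "c *\<^sub>R y n = T (s n)" for n
    using bounded_op s(1)[of n] c(1) by (simp add: y_def bounded_operator_def)
  then have "weakly_tendsto (\<lambda>n. T (s (r n))) (c *\<^sub>R l)"
    using weakly_tendsto_scaleR[OF r(2), of c] by simp
  with r(1) show thesis by (rule that)
qed

lemma seq_uaw_compact_if_weakly_compact:
  fixes T :: "'x \<Rightarrow> 'e::banach_lattice"
  assumes lattice: "lattice_ops_seq_weakly_continuous TYPE('e)"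
    and X: "banach_space X" and T: "weakly_compact_operator X T"
  shows "seq_uaw_compact_operator X T"
  unfolding seq_uaw_compact_operator_def
proof (intro conjI allI impI)
  show "bounded_operator X T"
    using T by (simp add: weakly_compact_operator_def)
  fix s :: "nat \<Rightarrow> 'x" assume s: "(\<forall>n. s n \<in> carr X) \<and> (\<exists>M. \<forall>n. nrm X (s n) \<le> M)"
  then obtain M where "\<And>n. s n \<in> carr X" "\<And>n. nrm X (s n) \<le> M" by blast
  from weakly_compact_operator_subseq[OF X T this] obtain r l
    where r: "strict_mono (r :: nat \<Rightarrow> nat)" "weakly_tendsto (\<lambda>n. T (s (r n))) l" .
  have "weakly_tendsto (\<lambda>n. T (s (r n)) - l) 0"
    using weakly_tendsto_diff_const[OF r(2), of l] by simp
  then have abs: "weakly_tendsto (\<lambda>n. \<bar>T (s (r n)) - l\<bar>) 0"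
    using lattice by (simp add: lattice_ops_seq_weakly_continuous_def)
  \<comment> \<open>The infimum with \<open>u\<close> lies below the modulus, which is already
    weakly null.\<close>
  have "uaw_tendsto (\<lambda>n. T (s (r n))) l"
    unfolding uaw_tendsto_def
    by (intro allI impI weakly_tendsto_0_dominated[OF abs]) simp
  with r(1) show "\<exists>r l. strict_mono (r :: nat \<Rightarrow> nat) \<and> uaw_tendsto (\<lambda>n. T (s (r n))) l"
    by blast
qed

lemma lattice_ops_if_ell1_operators_seq_uaw_compact:
  assumes compact: "\<And>T :: (nat \<Rightarrow> real) \<Rightarrow> 'e::banach_lattice.
      weakly_compact_operator ell1 T \<Longrightarrow> seq_uaw_compact_operator ell1 T"
  shows "lattice_ops_seq_weakly_continuous TYPE('e)"
  unfolding lattice_ops_seq_weakly_continuous_def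
proof (intro allI impI)
  fix x :: "nat \<Rightarrow> 'e" assume x: "weakly_tendsto x 0"
  interpret weakly_null_sequence x by (unfold_locales) (rule x)
  show "weakly_tendsto (\<lambda>n. \<bar>x n\<bar>) 0"
  proof (rule weakly_tendsto_0_if_positive, rule ccontr)
    fix h :: "'e \<Rightarrow>\<^sub>L real"
    assume h: "positive_functional h" and "\<not> (\<lambda>n. h \<bar>\<bar>x n\<bar>\<bar>) \<longlonglongrightarrow> 0"
    then have "\<not> (\<lambda>n. h \<bar>x n\<bar>) \<longlonglongrightarrow> 0" by simp
    \<comment> \<open>The operator yields limits of subsequences only, so the failure is first
      confined to a subsequence bounded below by \<open>e\<close>; every further subsequence
      inherits this bound.\<close>
    then obtain e and q :: "nat \<Rightarrow> nat"
      where e: "0 < e" and q: "strict_mono q" "\<And>n. e \<le> h \<bar>x (q n)\<bar>"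
      by (rule not_tendsto_0_subseq[rotated]) (auto intro: positive_functional_nonneg[OF h])
    let ?s = "\<lambda>k n. of_bool (n = q k) :: real"
    have "(\<lambda>n. \<bar>?s k n\<bar>) sums (\<Sum>n\<in>{q k}. \<bar>?s k n\<bar>)" for k
      by (rule sums_finite) auto
    then have "?s k \<in> carr ell1" "nrm ell1 (?s k) \<le> 1" for k
      by (auto simp: sums_iff)
    from seq_uaw_compact_operatorD[OF compact[OF weakly_compact_series_operator] this]
    obtain r l where r: "strict_mono (r :: nat \<Rightarrow> nat)"
      and uaw: "uaw_tendsto (\<lambda>n. series_operator (?s (r n))) l" .
    have "strict_mono (q \<circ> r)"
      using q(1) r by (rule strict_mono_o)
    then have "weakly_tendsto (\<lambda>n. x (q (r n))) 0"
      using x LIMSEQ_subseq_LIMSEQ[of _ _ "q \<circ> r"] by (fastforce simp: weakly_tendsto_iff o_def)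
    moreover have "uaw_tendsto (\<lambda>n. x (q (r n))) l"
      using uaw by (simp only: series_operator_unit)
    \<comment> \<open>The uaw-limit \<open>l\<close> is unknown beforehand, but has to be the weak
      limit \<open>0\<close>.\<close>
    ultimately have "weakly_tendsto (\<lambda>n. \<bar>x (q (r n)) - 0\<bar>) 0"
      by (rule weak_and_uaw_limit(2))
    then have "(\<lambda>n. h \<bar>x (q (r n))\<bar>) \<longlonglongrightarrow> 0"
      by (simp add: weakly_tendsto_iff blinfun.zero_right)
    then have "e \<le> 0"
      using q(2) by (intro LIMSEQ_le_const) auto
    with e show False by simp
  qed
qed

theorem theorem2p12:
  shows "(lattice_ops_seq_weakly_continuous TYPE('e::banach_lattice) \<longleftrightarrow>
            (\<forall>(X :: ('u + (nat \<Rightarrow> real)) nspace) (T :: 'u + (nat \<Rightarrow> real) \<Rightarrow> 'e).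
               banach_space X \<longrightarrow> weakly_compact_operator X T \<longrightarrow> seq_uaw_compact_operator X T))
       \<and> (lattice_ops_seq_weakly_continuous TYPE('e) \<longleftrightarrow>
            (\<forall>T :: (nat \<Rightarrow> real) \<Rightarrow> 'e.
               weakly_compact_operator ell1 T \<longrightarrow> seq_uaw_compact_operator ell1 T))"
    (is "(?one \<longleftrightarrow> ?two) \<and> (?one \<longleftrightarrow> ?three)")
proof -
  have "?two" if ?one
    using seq_uaw_compact_if_weakly_compact[OF that] by blast
  moreover have "?three" if two: ?two
  proof (intro allI impI)
    fix T :: "(nat \<Rightarrow> real) \<Rightarrow> 'e"
    assume T: "weakly_compact_operator ell1 T"
    \<comment> \<open>The spaces in (2) live in a sum type whose right summand has room for
      \<open>ell1\<close> for every \<open>'u\<close>; the copy under \<open>Inr\<close> is a Banach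
      space there.\<close>
    let ?i = "Inr :: (nat \<Rightarrow> real) \<Rightarrow> 'u + (nat \<Rightarrow> real)"
    have i: "inj ?i" by simp
    have "banach_space (nspace_copy ?i ell1)"
      by (rule banach_space_copy[OF banach_space_ell1 i])
    moreover have "weakly_compact_operator (nspace_copy ?i ell1) (T \<circ> inv ?i)"
      using T weakly_compact_operator_copy[OF i] by blast
    ultimately have "seq_uaw_compact_operator (nspace_copy ?i ell1) (T \<circ> inv ?i)"
      using two by blast
    then show "seq_uaw_compact_operator ell1 T"
      by (rule seq_uaw_compact_operator_copy[OF i])
  qed
  moreover have "?one" if ?three
    by (rule lattice_ops_if_ell1_operators_seq_uaw_compact) (use that in blast)
  ultimately show ?thesis by blast
qed

end
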